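(* There is a one-to-one correspondence between (i) exact lcs Lie algebras $(\mathfrak{g},\ \Omega=d\eta-\vartheta\wedge\eta,\ \vartheta)$ with $\dim\mathfrak{g}=2n$ such that $\vartheta(U)\neq 0$, where $U\in\mathfrak{g}$ is the vector determined by $\eta=-\imath_U\Omega$; and (ii) contact Lie algebras $(\mathfrak{h},\eta)$ with $\dim\mathfrak{h}=2n-1$, endowed with a derivation $D$ such that $D^*\eta=\alpha\eta$ for some $\alpha\neq 1$. The correspondence sends $(\mathfrak{g},\Omega,\vartheta)$ to $(\ker\vartheta,\eta,\mathrm{ad}_U)$; conversely, $(\mathfrak{h},\eta,D)$ is sent to $(\mathfrak{h}\rtimes_D\mathbb{R},\ d\eta-\vartheta\wedge\eta,\ \vartheta)$, where $\vartheta(X,a)=-a$. The exact lcs structure is of the first kind if and only if $\vartheta(U)=1$, if and only if $\alpha=0$.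
   Context: All Lie algebras are real and finite-dimensional; $d$ denotes the Chevalley–Eilenberg differential of the Lie algebra ($d\beta(X,Y)=-\beta([X,Y])$ for a $1$-form $\beta$). For a Lie algebra $\mathfrak{g}$ with $\dim\mathfrak{g}=2n\geq 4$, a locally conformally symplectic (lcs) structure is a pair $(\Omega,\vartheta)$ with $\Omega\in\Lambda^2\mathfrak{g}^*$, $\vartheta\in\mathfrak{g}^*$, $\Omega^n\neq 0$, $d\vartheta=0$ and $d\Omega=\vartheta\wedge\Omega$. It is exact if $\Omega=d\eta-\vartheta\wedge\eta$ for some $\eta\in\mathfrak{g}^*$ (a primitive of $\Omega$). Let $\mathfrak{g}_\Omega=\{X\in\mathfrak{g}\mid L_X\Omega=0\}$, where $L_X=\imath_Xd+d\imath_X$; the structure is of the first kind if the linear map $\mathfrak{g}_\Omega\to\mathbb{R}$, $X\mapsto\vartheta(X)$, is non-zero. A contact Lie algebra is a $(2n-1)$-dimensional Lie algebra $\mathfrak{h}$ with a $1$-form $\eta\in\mathfrak{h}^*$ such that $\eta\wedge(d\eta)^{n-1}\neq 0$. For a linear map $D:\mathfrak{h}\to\mathfrak{h}$, $D^*\eta$ is defined by $(D^*\eta)(X)=\eta(DX)$. If $D$ is a derivation, the semidirect product $\mathfrak{h}\rtimes_D\mathbb{R}$ is $\mathfrak{h}\oplus\mathbb{R}$ with bracket $[(X,a),(Y,b)]=(aD(Y)-bD(X)+[X,Y]_{\mathfrak{h}},0)$. In the passage from (i) to (ii), $\eta$ and $\mathrm{ad}_U$ are restricted to $\ker\vartheta$;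 in the passage from (ii) to (i), $\eta\in\mathfrak{h}^*$ is extended to $\mathfrak{h}\rtimes_D\mathbb{R}$ by $\eta(X,a)=\eta(X)$.
   Formalization: The two assignments are not mutually inverse as written (a round trip turns D into D/(α−1), and ϑ into −ϑ/ϑ(U)); proved instead: each is a bijection on isomorphism classes (isomorphisms preserving η), and both composites are these rescalings. *)

theory Defs
  imports "HOL-Analysis.Analysis" "HOL-Combinatorics.Permutations"
begin

section \<open>Exterior forms on a subspace of a real vector space\<close>

text \<open>
  A form of degree \<open>k\<close> on a subspace \<open>V\<close> is a function on lists, of which only the values on
  lists of length \<open>k\<close> with entries in \<open>V\<close> are relevant.  Hence equality of forms is always
  relative to \<open>V\<close> and \<open>k\<close> (\<open>form_eq\<close>), and the restriction of a form to a smaller subspace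
  is the same function, regarded on that subspace.
\<close>

type_synonym 'a form = "'a list \<Rightarrow> real"

definition linear_within :: "'a::real_vector set \<Rightarrow> ('a \<Rightarrow> 'b::real_vector) \<Rightarrow> bool" where
  "linear_within V f \<longleftrightarrow>
     (\<forall>x\<in>V. \<forall>y\<in>V. f (x + y) = f x + f y) \<and> (\<forall>c. \<forall>x\<in>V. f (c *\<^sub>R x) = c *\<^sub>R f x)"

definition arguments :: "'a set \<Rightarrow> nat \<Rightarrow> 'a list set" where
  "arguments V k = {xs. length xs = k \<and> set xs \<subseteq> V}"

definition exterior_form :: "'a::real_vector set \<Rightarrow> nat \<Rightarrow> 'a form \<Rightarrow> bool" where
  "exterior_form V k \<omega> \<longleftrightarrow>
     (\<forall>xs \<in> arguments V k. \<forall>i<k. linear_within V (\<lambda>x. \<omega> (xs[i := x]))) \<and>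
     (\<forall>xs \<in> arguments V k. \<forall>i<k. \<forall>j<k. i \<noteq> j \<longrightarrow> xs ! i = xs ! j \<longrightarrow> \<omega> xs = 0)"

definition form_eq :: "'a set \<Rightarrow> nat \<Rightarrow> 'a form \<Rightarrow> 'a form \<Rightarrow> bool" where
  "form_eq V k \<alpha> \<beta> \<longleftrightarrow> (\<forall>xs \<in> arguments V k. \<alpha> xs = \<beta> xs)"

text \<open>
  \<open>wedge p q \<alpha> \<beta>\<close> is the product of a \<open>p\<close>-form and a \<open>q\<close>-form, normalised such that
  \<open>(\<alpha> \<and> \<beta>)(X, Y) = \<alpha>(X) \<beta>(Y) - \<alpha>(Y) \<beta>(X)\<close> for \<open>p = q = 1\<close>.
\<close>

definition wedge :: "nat \<Rightarrow> nat \<Rightarrow> 'a form \<Rightarrow> 'a form \<Rightarrow> 'a form" where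
  "wedge p q \<alpha> \<beta> xs =
     (\<Sum>\<sigma> | \<sigma> permutes {..<p + q}.
        of_int (sign \<sigma>) * \<alpha> (map (\<lambda>i. xs ! \<sigma> i) [0..<p]) * \<beta> (map (\<lambda>i. xs ! \<sigma> i) [p..<p + q]))
     / (fact p * fact q)"

fun wedge_power :: "nat \<Rightarrow> 'a form \<Rightarrow> nat \<Rightarrow> 'a form" where
  "wedge_power p \<omega> 0 = (\<lambda>xs. 1)"
| "wedge_power p \<omega> (Suc k) = wedge p (p * k) \<omega> (wedge_power p \<omega> k)"

definition interior_prod :: "'a \<Rightarrow> 'a form \<Rightarrow> 'a form" where
  "interior_prod X \<omega> xs = \<omega> (X # xs)"

definition pullback :: "('a \<Rightarrow> 'b) \<Rightarrow> 'b form \<Rightarrow> 'a form" where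
  "pullback f \<omega> xs = \<omega> (map f xs)"


section \<open>Lie algebras\<close>

record 'a lie =
  lspace :: "'a set"
  bracket :: "'a \<Rightarrow> 'a \<Rightarrow> 'a"

definition lie_algebra :: "('a::real_vector, 'z) lie_scheme \<Rightarrow> bool" where
  "lie_algebra g \<longleftrightarrow>
     subspace (lspace g) \<and> (\<exists>S. finite S \<and> span S = lspace g) \<and>
     (\<forall>x\<in>lspace g. \<forall>y\<in>lspace g. bracket g x y \<in> lspace g) \<and>
     (\<forall>x\<in>lspace g. linear_within (lspace g) (bracket g x)) \<and>
     (\<forall>y\<in>lspace g. linear_within (lspace g) (\<lambda>x. bracket g x y)) \<and>
     (\<forall>x\<in>lspace g. bracket g x x = 0) \<and>
     (\<forall>x\<in>lspace g. \<forall>y\<in>lspace g. \<forall>z\<in>lspace g.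
        bracket g x (bracket g y z) + bracket g y (bracket g z x) + bracket g z (bracket g x y) = 0)"

definition derivation :: "('a::real_vector, 'z) lie_scheme \<Rightarrow> ('a \<Rightarrow> 'a) \<Rightarrow> bool" where
  "derivation g D \<longleftrightarrow>
     (\<forall>x\<in>lspace g. D x \<in> lspace g) \<and> linear_within (lspace g) D \<and>
     (\<forall>x\<in>lspace g. \<forall>y\<in>lspace g. D (bracket g x y) = bracket g (D x) y + bracket g x (D y))"

definition lie_iso ::
  "('a::real_vector \<Rightarrow> 'b::real_vector) \<Rightarrow> ('a, 'z) lie_scheme \<Rightarrow> ('b, 'w) lie_scheme \<Rightarrow> bool" where
  "lie_iso f g g' \<longleftrightarrow>
     linear_within (lspace g) f \<and> bij_betw f (lspace g) (lspace g') \<and>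
     (\<forall>x\<in>lspace g. \<forall>y\<in>lspace g. f (bracket g x y) = bracket g' (f x) (f y))"

text \<open>
  The Chevalley--Eilenberg differential (trivial coefficients); \<open>nths xs (- {i, j})\<close> is \<open>xs\<close>
  with the entries at positions \<open>i\<close> and \<open>j\<close> omitted.
\<close>

definition ce_diff :: "('a, 'z) lie_scheme \<Rightarrow> 'a form \<Rightarrow> 'a form" where
  "ce_diff g \<omega> xs =
     (\<Sum>j<length xs. \<Sum>i<j.
        (- 1) ^ (i + j) * \<omega> (bracket g (xs ! i) (xs ! j) # nths xs (- {i, j})))"

definition lie_deriv :: "('a, 'z) lie_scheme \<Rightarrow> 'a \<Rightarrow> 'a form \<Rightarrow> 'a form" where
  "lie_deriv g X \<omega> xs =
     interior_prod X (ce_diff g \<omega>) xs + ce_diff g (interior_prod X \<omega>) xs"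


section \<open>Exact locally conformally symplectic Lie algebras\<close>

text \<open>
  The vector \<open>U\<close> below depends on the primitive \<open>\<eta>\<close> and not only on \<open>\<Omega>\<close> and \<open>\<vartheta>\<close>,
  so a chosen primitive belongs to the data.
\<close>

record 'a lcs = "'a lie" +
  Omega :: "'a form"
  lee :: "'a form"
  prim :: "'a form"

definition is_lcs :: "nat \<Rightarrow> ('a::real_vector, 'z) lcs_scheme \<Rightarrow> bool" where
  "is_lcs n A \<longleftrightarrow>
     lie_algebra A \<and> dim (lspace A) = 2 * n \<and>
     exterior_form (lspace A) 2 (Omega A) \<and> exterior_form (lspace A) 1 (lee A) \<and>
     \<not> form_eq (lspace A) (2 * n) (wedge_power 2 (Omega A) n) (\<lambda>_. 0) \<and>
     form_eq (lspace A) 2 (ce_diff A (lee A)) (\<lambda>_. 0) \<and>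
     form_eq (lspace A) 3 (ce_diff A (Omega A)) (wedge 1 2 (lee A) (Omega A))"

definition is_exact_lcs :: "nat \<Rightarrow> ('a::real_vector, 'z) lcs_scheme \<Rightarrow> bool" where
  "is_exact_lcs n A \<longleftrightarrow>
     is_lcs n A \<and> exterior_form (lspace A) 1 (prim A) \<and>
     form_eq (lspace A) 2 (Omega A)
       (\<lambda>xs. ce_diff A (prim A) xs - wedge 1 1 (lee A) (prim A) xs)"

definition determines_U :: "('a, 'z) lcs_scheme \<Rightarrow> 'a \<Rightarrow> bool" where
  "determines_U A U \<longleftrightarrow>
     U \<in> lspace A \<and> form_eq (lspace A) 1 (prim A) (\<lambda>xs. - interior_prod U (Omega A) xs)"

definition vecU :: "('a, 'z) lcs_scheme \<Rightarrow> 'a" where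
  "vecU A = (THE U. determines_U A U)"

definition lcs_automorphisms :: "('a, 'z) lcs_scheme \<Rightarrow> 'a set" where
  "lcs_automorphisms A =
     {X \<in> lspace A. form_eq (lspace A) 2 (lie_deriv A X (Omega A)) (\<lambda>_. 0)}"

definition first_kind :: "('a, 'z) lcs_scheme \<Rightarrow> bool" where
  "first_kind A \<longleftrightarrow> (\<exists>X \<in> lcs_automorphisms A. lee A [X] \<noteq> 0)"

definition lcs_isomorphic ::
  "('a::real_vector, 'z) lcs_scheme \<Rightarrow> ('b::real_vector, 'w) lcs_scheme \<Rightarrow> bool" where
  "lcs_isomorphic A A' \<longleftrightarrow>
     (\<exists>f. lie_iso f A A' \<and>
        form_eq (lspace A) 2 (pullback f (Omega A')) (Omega A) \<and>
        form_eq (lspace A) 1 (pullback f (lee A')) (lee A) \<and>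
        form_eq (lspace A) 1 (pullback f (prim A')) (prim A))"

definition transversal_lcs :: "nat \<Rightarrow> ('a::real_vector, 'z) lcs_scheme \<Rightarrow> bool" where
  "transversal_lcs n A \<longleftrightarrow> is_exact_lcs n A \<and> lee A [vecU A] \<noteq> 0"


section \<open>Contact Lie algebras with a derivation\<close>

record 'a contact = "'a lie" +
  cform :: "'a form"
  der :: "'a \<Rightarrow> 'a"

definition is_contact :: "nat \<Rightarrow> ('a::real_vector, 'z) contact_scheme \<Rightarrow> bool" where
  "is_contact n B \<longleftrightarrow>
     lie_algebra B \<and> dim (lspace B) = 2 * n - 1 \<and> exterior_form (lspace B) 1 (cform B) \<and>
     \<not> form_eq (lspace B) (2 * n - 1)
         (wedge 1 (2 * (n - 1)) (cform B) (wedge_power 2 (ce_diff B (cform B)) (n - 1))) (\<lambda>_. 0)"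

definition has_eigenvalue :: "('a, 'z) contact_scheme \<Rightarrow> real \<Rightarrow> bool" where
  "has_eigenvalue B \<alpha> \<longleftrightarrow>
     form_eq (lspace B) 1 (pullback (der B) (cform B)) (\<lambda>xs. \<alpha> * cform B xs)"

definition contact_der :: "nat \<Rightarrow> ('a::real_vector, 'z) contact_scheme \<Rightarrow> bool" where
  "contact_der n B \<longleftrightarrow>
     is_contact n B \<and> derivation B (der B) \<and> (\<exists>\<alpha>. \<alpha> \<noteq> 1 \<and> has_eigenvalue B \<alpha>)"

definition contact_isomorphic ::
  "('a::real_vector, 'z) contact_scheme \<Rightarrow> ('b::real_vector, 'w) contact_scheme \<Rightarrow> bool" where
  "contact_isomorphic B B' \<longleftrightarrow>
     (\<exists>f. lie_iso f B B' \<and>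
        form_eq (lspace B) 1 (pullback f (cform B')) (cform B) \<and>
        (\<forall>x\<in>lspace B. f (der B x) = der B' (f x)))"


section \<open>The two constructions\<close>

definition to_contact :: "'a lcs \<Rightarrow> 'a contact" where
  "to_contact A =
     \<lparr> lspace = {X \<in> lspace A. lee A [X] = 0}, bracket = bracket A,
       cform = prim A, der = bracket A (vecU A) \<rparr>"

definition semidirect :: "('a::real_vector, 'z) lie_scheme \<Rightarrow> ('a \<Rightarrow> 'a) \<Rightarrow> ('a \<times> real) lie" where
  "semidirect h D =
     \<lparr> lspace = lspace h \<times> UNIV,
       bracket = (\<lambda>(X, a) (Y, b). (a *\<^sub>R D Y - b *\<^sub>R D X + bracket h X Y, 0)) \<rparr>"

definition exact_lcs_of :: "('a, 'z) lie_scheme \<Rightarrow> 'a form \<Rightarrow> 'a form \<Rightarrow> 'a lcs" where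
  "exact_lcs_of g \<theta> \<eta> =
     \<lparr> lspace = lspace g, bracket = bracket g,
       Omega = (\<lambda>xs. ce_diff g \<eta> xs - wedge 1 1 \<theta> \<eta> xs), lee = \<theta>, prim = \<eta> \<rparr>"

definition to_lcs :: "'a::real_vector contact \<Rightarrow> ('a \<times> real) lcs" where
  "to_lcs B =
     exact_lcs_of (semidirect B (der B)) (\<lambda>xs. - snd (hd xs)) (pullback fst (cform B))"

end

theory Submission
  imports Defs
begin

text \<open>
  Everything rests on the contraction identity \<open>\<iota>\<^sub>U \<Omega>\<^sup>n = n (\<iota>\<^sub>U \<Omega>) \<and> \<Omega>\<^sup>n\<^sup>-\<^sup>1\<close>.  Since \<open>\<iota>\<^sub>U \<Omega> = -\<eta>\<close> and
  \<open>\<Omega>\<close> restricts to \<open>d\<eta>\<close> on \<open>ker \<vartheta>\<close>, it shows that \<open>\<Omega>\<^sup>n \<noteq> 0\<close> holds exactly when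
  \<open>\<eta> \<and> (d\<eta>)\<^sup>n\<^sup>-\<^sup>1 \<noteq> 0\<close> on \<open>ker \<vartheta>\<close>, provided that \<open>U\<close> is transversal to \<open>ker \<vartheta>\<close>; no symplectic basis and
  no Reeb vector are needed.  The relation \<open>\<eta> = -\<iota>\<^sub>U \<Omega>\<close> evaluated on \<open>ker \<vartheta>\<close> reads
  \<open>\<eta>([U, X]) = (1 - \<vartheta>(U)) \<eta>(X)\<close>, so \<open>\<alpha> = 1 - \<vartheta>(U)\<close>; conversely \<open>U = (0, 1 / (\<alpha> - 1))\<close> in the
  semidirect product.  All isomorphisms come from \<open>(X, a) \<mapsto> X + a U\<close>, which identifies
  \<open>ker \<vartheta> \<rtimes> \<real>\<close> with the given Lie algebra.
\<close>

section \<open>Alternating sums over permutations\<close>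

text \<open>Taken literally, the two assignments are not mutually inverse. In the semidirect product
  \<open>U\<close> is \<open>(0, 1 / (\<alpha> - 1))\<close>, so passing from \<open>B\<close> to
  \<open>to_lcs B\<close> and back multiplies the derivation by \<open>1 / (\<alpha> - 1)\<close>;
  in the other order the Lee form becomes \<open>- \<vartheta> / \<vartheta>(U)\<close>. The
  correspondence is therefore a bijection of isomorphism classes. Two facts make this work: the map
  \<alpha> \<mapsto> \<alpha> / (\<alpha> - 1) that the rescaling induces on eigenvalues is an
  involution of the reals other than 1, so rescaling the derivation beforehand cancels the factor;
  and the eigenvalue, hence \<vartheta>(U), is an invariant of the contact data. The computational
  obstacle is \<open>wedge_power\<close>, an iterated product in which every stage is a normalised
  sum over permutations. It is turned into one alternating sum, over the permutations of all
  \<open>2 * k\<close> arguments, of a product of \<open>k\<close> values of the 2-form;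
  contraction, multilinearity and the effect of a radical vector can be read off from that sum.
  Argument tuples become functions on indices, so that permutations act by composition.\<close>

definition altf :: "nat \<Rightarrow> ((nat \<Rightarrow> 'a) \<Rightarrow> real) \<Rightarrow> (nat \<Rightarrow> 'a) \<Rightarrow> real" where
  "altf m P f = (\<Sum>\<sigma> | \<sigma> permutes {..<m}. of_int (sign \<sigma>) * P (f \<circ> \<sigma>))"

text \<open>The summand of the \<open>k\<close>-th power of a 2-form before antisymmetrisation:
  slots \<open>2 * j\<close> and \<open>2 * j + 1\<close> feed factor \<open>j\<close>.\<close>

definition pair_prod :: "('a \<Rightarrow> 'a \<Rightarrow> real) \<Rightarrow> nat \<Rightarrow> (nat \<Rightarrow> 'a) \<Rightarrow> real" where
  "pair_prod w k f = (\<Prod>j<k. w (f (2 * j)) (f (Suc (2 * j))))"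

text \<open>Embeds the permutations of \<open>q\<close> letters into those of \<open>p + q\<close>
  letters as the ones that fix the first \<open>p\<close> positions.\<close>

definition shift_perm :: "nat \<Rightarrow> nat \<Rightarrow> (nat \<Rightarrow> nat) \<Rightarrow> nat \<Rightarrow> nat" where
  "shift_perm p q = map_permutation {..<q} ((+) p)"

lemma permutation_if_permutes: "\<sigma> permutes {..<m::nat} \<Longrightarrow> permutation \<sigma>"
  by (rule permutes_imp_permutation[of "{..<m}"]) auto

lemma shift_perm_permutes:
  assumes "\<tau> permutes {..<q}" shows "shift_perm p q \<tau> permutes {..<p + q}"
proof -
  have "bij_betw ((+) p) {..<q} {p..<p + q}"
    by (rule bij_betwI[where g = "\<lambda>i. i - p"]) auto
  then have "shift_perm p q \<tau> permutes {p..<p + q}"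
    unfolding shift_perm_def using assms by (rule map_permutation_permutes)
  then show ?thesis by (rule permutes_subset) auto
qed

lemma shift_perm_low: "i < p \<Longrightarrow> shift_perm p q \<tau> i = i"
  unfolding shift_perm_def map_permutation_def restrict_id_def by auto

lemma shift_perm_high:
  assumes "\<tau> permutes {..<q}" shows "shift_perm p q \<tau> (p + j) = p + \<tau> j"
proof (cases "j < q")
  case True
  then show ?thesis unfolding shift_perm_def by (subst map_permutation_apply) auto
next
  case False
  then have "shift_perm p q \<tau> (p + j) = p + j"
    unfolding shift_perm_def map_permutation_def restrict_id_def by auto
  moreover have "\<tau> j = j" using assms False by (auto simp: permutes_not_in)
  ultimately show ?thesis by simp
qed

lemma sign_shift_perm: "\<tau> permutes {..<q} \<Longrightarrow> sign (shift_perm p q \<tau>) = sign \<tau>"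
  unfolding shift_perm_def by (rule sign_map_permutation) auto

text \<open>Reindex the sum by \<sigma> \<mapsto> \<sigma> \<circ> \<rho>; the sign is
  multiplicative and squares to 1. Thus permuting the slots of the summand costs only a
  sign.\<close>

lemma altf_compose:
  assumes \<rho>: "\<rho> permutes {..<m}"
  shows "altf m (\<lambda>g. P (g \<circ> \<rho>)) f = of_int (sign \<rho>) * altf m P f"
proof -
  have "altf m P f = (\<Sum>\<sigma> | \<sigma> permutes {..<m}. of_int (sign (\<sigma> \<circ> \<rho>)) * P (f \<circ> (\<sigma> \<circ> \<rho>)))"
    unfolding altf_def by (rule sum_permutations_compose_right[OF \<rho>])
  also have "\<dots> = (\<Sum>\<sigma> | \<sigma> permutes {..<m}.
      of_int (sign \<rho>) * (of_int (sign \<sigma>) * P (f \<circ> \<sigma> \<circ> \<rho>)))"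
    by (intro sum.cong refl)
      (simp add: sign_compose permutation_if_permutes[OF \<rho>] permutation_if_permutes o_assoc)
  also have "\<dots> = of_int (sign \<rho>) * altf m (\<lambda>g. P (g \<circ> \<rho>)) f"
    by (simp add: altf_def sum_distrib_left)
  finally have "altf m P f = of_int (sign \<rho>) * altf m (\<lambda>g. P (g \<circ> \<rho>)) f" .
  then have "of_int (sign \<rho>) * altf m P f
      = of_int (sign \<rho> * sign \<rho>) * altf m (\<lambda>g. P (g \<circ> \<rho>)) f"
    unfolding of_int_mult mult.assoc by (rule arg_cong)
  then show ?thesis by simp
qed

lemma altf_cong:
  assumes "\<And>i. i < m \<Longrightarrow> f i = g i"
    and "\<And>f g. (\<And>i. i < m \<Longrightarrow> f i = g i) \<Longrightarrow> P f = Q g"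
  shows "altf m P f = altf m Q g"
  unfolding altf_def
proof (intro sum.cong refl arg_cong2[where f = "(*)"] assms(2))
  fix \<sigma> i assume "\<sigma> \<in> {\<sigma>. \<sigma> permutes {..<m}}" "i < m"
  then have "\<sigma> i < m" using permutes_in_image[of \<sigma> "{..<m}" i] by auto
  then show "(f \<circ> \<sigma>) i = (g \<circ> \<sigma>) i" using assms(1) by simp
qed

lemma altf_scale: "altf m (\<lambda>g. c * P g) f = c * altf m P f"
  by (simp add: altf_def sum_distrib_left mult.left_commute)

text \<open>Composing on the left with the transposition of \<open>i\<close> and \<open>j\<close>
  leaves \<open>f\<close> unchanged and reverses every sign, so the sum equals its own
  negative.\<close>

lemma altf_repeated:
  assumes "i < m" "j < m" "i \<noteq> j" "f i = f j"
  shows "altf m P f = 0"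
proof -
  let ?t = "Transposition.transpose i j"
  have t: "?t permutes {..<m}" using assms by (intro permutes_swap_id) auto
  have ft: "f \<circ> ?t = f" using assms by (auto simp: Transposition.transpose_def fun_eq_iff)
  have "altf m P f = (\<Sum>\<sigma> | \<sigma> permutes {..<m}. of_int (sign (?t \<circ> \<sigma>)) * P (f \<circ> (?t \<circ> \<sigma>)))"
    unfolding altf_def by (rule setum_permutations_compose_left[OF t])
  also have "\<dots> = (\<Sum>\<sigma> | \<sigma> permutes {..<m}. - (of_int (sign \<sigma>) * P (f \<circ> \<sigma>)))"
    by (intro sum.cong refl)
      (simp add: sign_compose permutation_if_permutes permutation_swap_id sign_swap_id assms(3)
        o_assoc ft)
  also have "\<dots> = - altf m P f" by (simp add: altf_def sum_negf)
  finally show ?thesis by simp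
qed

text \<open>An inner antisymmetrisation is absorbed by the outer one: each of the \<open>q!\<close>
  inner permutations, moved to the last \<open>q\<close> slots, contributes the same by
  \<open>altf_compose\<close>. The factor \<open>A\<close> survives the move because it reads only
  the first \<open>p\<close> entries.\<close>

lemma altf_altf:
  assumes A: "\<And>f g. (\<And>i. i < p \<Longrightarrow> f i = g i) \<Longrightarrow> A f = A g"
  shows "altf (p + q) (\<lambda>g. A g * altf q P (\<lambda>j. g (p + j))) f
    = fact q * altf (p + q) (\<lambda>g. A g * P (\<lambda>j. g (p + j))) f"
proof -
  let ?Q = "\<lambda>g. A g * P (\<lambda>j. g (p + j))"
  have eq: "A g * P ((\<lambda>j. g (p + j)) \<circ> \<tau>) = ?Q (g \<circ> shift_perm p q \<tau>)"
    if "\<tau> permutes {..<q}" for g \<tau>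
  proof -
    have "A g = A (g \<circ> shift_perm p q \<tau>)" by (rule A) (simp add: shift_perm_low)
    then show ?thesis by (simp add: shift_perm_high[OF that] o_def)
  qed
  have "altf (p + q) (\<lambda>g. A g * altf q P (\<lambda>j. g (p + j))) f
    = (\<Sum>\<tau> | \<tau> permutes {..<q}. of_int (sign \<tau>) *
        altf (p + q) (\<lambda>g. A g * P ((\<lambda>j. g (p + j)) \<circ> \<tau>)) f)"
    unfolding altf_def sum_distrib_left
    by (subst sum.swap) (intro sum.cong refl, simp)
  also have "\<dots> = (\<Sum>\<tau> | \<tau> permutes {..<q}. of_int (sign \<tau>) *
        altf (p + q) (\<lambda>g. ?Q (g \<circ> shift_perm p q \<tau>)) f)"
    by (intro sum.cong refl) (simp add: eq)
  also have "\<dots> = (\<Sum>\<tau> | \<tau> permutes {..<q}. altf (p + q) ?Q f)"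
  proof (intro sum.cong refl)
    fix \<tau> assume "\<tau> \<in> {\<tau>. \<tau> permutes {..<q}}"
    then have t: "\<tau> permutes {..<q}" by simp
    show "of_int (sign \<tau>) * altf (p + q) (\<lambda>g. ?Q (g \<circ> shift_perm p q \<tau>)) f = altf (p + q) ?Q f"
      unfolding altf_compose[where P = ?Q, OF shift_perm_permutes[OF t]] sign_shift_perm[OF t]
      by (simp add: mult.assoc[symmetric] of_int_mult[symmetric] del: of_int_mult)
  qed
  also have "\<dots> = fact q * altf (p + q) ?Q f"
    by (simp add: card_permutations[of "{..<q}" q])
  finally show ?thesis .
qed

text \<open>The composite of the two transpositions exchanges the pairs 0 and \<open>j\<close> as
  blocks (it is the identity for \<open>j = 0\<close>), so it merely permutes the factors.\<close>

lemma pair_prod_swap: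
  assumes "j < k"
  shows "pair_prod w k (g \<circ> (Transposition.transpose 0 (2 * j) \<circ> Transposition.transpose 1 (Suc (2 * j))))
    = pair_prod w k g"
proof -
  let ?\<pi> = "Transposition.transpose 0 j" and ?h = "\<lambda>l. w (g (2 * l)) (g (Suc (2 * l)))"
  let ?\<rho> = "Transposition.transpose 0 (2 * j) \<circ> Transposition.transpose 1 (Suc (2 * j))"
  have \<rho>: "?\<rho> (2 * l) = 2 * ?\<pi> l" "?\<rho> (Suc (2 * l)) = Suc (2 * ?\<pi> l)" for l
    by (auto simp: Transposition.transpose_def) presburger+
  have "pair_prod w k (g \<circ> ?\<rho>) = prod (?h \<circ> ?\<pi>) {..<k}"
    unfolding pair_prod_def by (intro prod.cong refl) (simp only: o_apply \<rho>[unfolded o_apply])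
  also have "\<dots> = prod ?h {..<k}"
    by (rule prod.permute[symmetric], rule permutes_swap_id) (use assms in auto)
  finally show ?thesis by (simp add: pair_prod_def)
qed

lemma pair_prod_flip:
  assumes "j < k" "w (g (Suc (2 * j))) (g (2 * j)) = - w (g (2 * j)) (g (Suc (2 * j)))"
  shows "pair_prod w k (g \<circ> Transposition.transpose (2 * j) (Suc (2 * j))) = - pair_prod w k g"
proof -
  let ?h = "\<lambda>l. w (g (2 * l)) (g (Suc (2 * l)))"
  let ?t = "Transposition.transpose (2 * j) (Suc (2 * j))"
  have t: "?t (2 * l) = 2 * l" "?t (Suc (2 * l)) = Suc (2 * l)" if "l \<noteq> j" for l
    using that by (auto simp: Transposition.transpose_def)
  have "pair_prod w k (g \<circ> ?t) = - ?h j * prod ?h ({..<k} - {j})"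
    unfolding pair_prod_def
    by (subst prod.remove[of _ j]) (use assms in \<open>auto simp: t intro!: prod.cong\<close>)
  also have "\<dots> = - prod ?h {..<k}"
    by (subst prod.remove[of "{..<k}" j]) (use assms in auto)
  finally show ?thesis by (simp add: pair_prod_def)
qed

lemma pair_prod_Suc:
  "pair_prod w (Suc k) f = w (f 0) (f 1) * pair_prod w k (\<lambda>j. f (2 + j))"
  by (simp add: pair_prod_def prod.lessThan_Suc_shift del: prod.lessThan_Suc)

text \<open>The stabiliser of 0 is a copy of the permutations of one letter fewer. It reindexes the
  part of an alternating sum in which the first argument stays in place.\<close>

lemma permutes_fixing_0:
  "bij_betw (shift_perm 1 m) {\<tau>. \<tau> permutes {..<m}} {\<sigma>. \<sigma> permutes {..<Suc m} \<and> \<sigma> 0 = 0}"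
proof (rule bij_betwI[where g = "\<lambda>\<sigma> i. \<sigma> (1 + i) - 1"])
  show "shift_perm 1 m \<in> {\<tau>. \<tau> permutes {..<m}} \<rightarrow> {\<sigma>. \<sigma> permutes {..<Suc m} \<and> \<sigma> 0 = 0}"
    using shift_perm_permutes[of _ m 1] by (auto simp: shift_perm_low)
  \<comment> \<open>Keeps the truncated subtraction in the inverse map honest: only 0 is sent to
    0.\<close>
  have pos: "\<sigma> (1 + i) \<noteq> 0" if "\<sigma> permutes {..<Suc m}" "\<sigma> 0 = 0" for \<sigma> i
    using permutes_inj[OF that(1)] that(2) by (metis injD nat.simps(3) plus_1_eq_Suc)
  show "(\<lambda>\<sigma> i. \<sigma> (1 + i) - 1) \<in> {\<sigma>. \<sigma> permutes {..<Suc m} \<and> \<sigma> 0 = 0} \<rightarrow> {\<tau>. \<tau> permutes {..<m}}"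
  proof (intro funcsetI CollectI)
    fix \<sigma> assume "\<sigma> \<in> {\<sigma>. \<sigma> permutes {..<Suc m} \<and> \<sigma> 0 = 0}"
    then have s: "\<sigma> permutes {..<Suc m}" "\<sigma> 0 = 0" by auto
    show "(\<lambda>i. \<sigma> (1 + i) - 1) permutes {..<m}"
    proof (rule inj_imp_permutes)
      show "inj_on (\<lambda>i. \<sigma> (1 + i) - 1) {..<m}"
      proof (rule inj_onI)
        fix x y assume "\<sigma> (1 + x) - 1 = \<sigma> (1 + y) - 1"
        then have "\<sigma> (1 + x) = \<sigma> (1 + y)" using pos[OF s, of x] pos[OF s, of y] by linarith
        then show "x = y" using permutes_inj[OF s(1)] by (auto dest: injD)
      qed
      show "\<sigma> (1 + x) - 1 \<in> {..<m}" if "x \<in> {..<m}" for x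
        using permutes_in_image[OF s(1), of "1 + x"] that pos[OF s, of x] by auto
      show "\<sigma> (1 + x) - 1 = x" if "x \<notin> {..<m}" for x
        using permutes_not_in[OF s(1), of "1 + x"] that by auto
    qed auto
  qed
  show "(\<lambda>i. shift_perm 1 m \<tau> (1 + i) - 1) = \<tau>" if "\<tau> \<in> {\<tau>. \<tau> permutes {..<m}}" for \<tau>
    using shift_perm_high[of \<tau> m 1] that by (auto simp: fun_eq_iff)
  then show "shift_perm 1 m (\<lambda>i. \<sigma> (1 + i) - 1) = \<sigma>"
    if "\<sigma> \<in> {\<sigma>. \<sigma> permutes {..<Suc m} \<and> \<sigma> 0 = 0}" for \<sigma>
  proof -
    have s: "\<sigma> permutes {..<Suc m}" "\<sigma> 0 = 0" using that by auto
    have t: "(\<lambda>i. \<sigma> (1 + i) - 1) permutes {..<m}"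
      using \<open>(\<lambda>\<sigma> i. \<sigma> (1 + i) - 1) \<in> _ \<rightarrow> _\<close> that by blast
    show ?thesis
    proof
      fix i show "shift_perm 1 m (\<lambda>i. \<sigma> (1 + i) - 1) i = \<sigma> i"
        using shift_perm_high[OF t, of 1 "i - 1"] pos[OF s, of "i - 1"] s(2)
        by (cases i) (auto simp: shift_perm_low)
    qed
  qed
qed

text \<open>
  The sum defining the left-hand side is split according to the position of the argument \<open>f 0\<close>;
  permuting the factors and flipping a factor shows that all positions contribute equally.
\<close>

lemma altf_pair_prod_contract:
  assumes anti: "\<And>i j. i < 2 * Suc k \<Longrightarrow> j < 2 * Suc k \<Longrightarrow> w (f i) (f j) = - w (f j) (f i)"
  shows "altf (2 * Suc k) (pair_prod w (Suc k)) f
    = real (2 * Suc k) *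
      altf (Suc (2 * k)) (\<lambda>g. w (f 0) (g 0) * pair_prod w k (\<lambda>j. g (1 + j))) (\<lambda>j. f (1 + j))"
    (is "_ = _ * ?R")
proof -
  let ?m = "2 * Suc k" and ?P = "pair_prod w (Suc k)"
  \<comment> \<open>\<open>T i\<close> collects the permutations that put the argument
    \<open>f 0\<close> into slot \<open>i\<close>.\<close>
  define T where "T i = (\<Sum>\<sigma> | \<sigma> permutes {..<?m}.
      if \<sigma> i = 0 then of_int (sign \<sigma>) * ?P (f \<circ> \<sigma>) else 0)" for i
  \<comment> \<open>A slot permutation \<rho> that preserves the summand up to its own sign carries
    \<open>T i\<close> to \<open>T (\<rho> i)\<close>. Block exchanges reach the even slots from
    slot 0, and flips within a block reach the odd ones.\<close>
  have T_eq: "T (\<rho> i) = T i"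
    if \<rho>: "\<rho> permutes {..<?m}"
      and inv: "\<And>\<sigma>. \<sigma> permutes {..<?m} \<Longrightarrow> of_int (sign \<rho>) * ?P (f \<circ> \<sigma> \<circ> \<rho>) = ?P (f \<circ> \<sigma>)" for \<rho> i
  proof -
    have "T i = (\<Sum>\<sigma> | \<sigma> permutes {..<?m}.
        if (\<sigma> \<circ> \<rho>) i = 0 then of_int (sign (\<sigma> \<circ> \<rho>)) * ?P (f \<circ> (\<sigma> \<circ> \<rho>)) else 0)"
      unfolding T_def by (rule sum_permutations_compose_right[OF \<rho>])
    also have "\<dots> = T (\<rho> i)"
      unfolding T_def
    proof (intro sum.cong refl)
      fix \<sigma> assume "\<sigma> \<in> {\<sigma>. \<sigma> permutes {..<?m}}"
      then have s: "\<sigma> permutes {..<?m}" by simp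
      have "of_int (sign (\<sigma> \<circ> \<rho>)) * ?P (f \<circ> (\<sigma> \<circ> \<rho>)) = of_int (sign \<sigma>) * ?P (f \<circ> \<sigma>)"
        using inv[OF s] permutation_if_permutes[OF s] permutation_if_permutes[OF \<rho>]
        by (simp add: sign_compose o_assoc)
      then show "(if (\<sigma> \<circ> \<rho>) i = 0 then of_int (sign (\<sigma> \<circ> \<rho>)) * ?P (f \<circ> (\<sigma> \<circ> \<rho>)) else 0)
        = (if \<sigma> (\<rho> i) = 0 then of_int (sign \<sigma>) * ?P (f \<circ> \<sigma>) else 0)" by simp
    qed
    finally show ?thesis by simp
  qed
  have even: "T (2 * j) = T 0" if "j < Suc k" for j
  proof -
    let ?a = "Transposition.transpose 0 (2 * j)" and ?b = "Transposition.transpose 1 (Suc (2 * j))"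
    have p: "?a permutes {..<?m}" "?b permutes {..<?m}"
      using that by (intro permutes_swap_id; auto)+
    have sgn: "sign (?a \<circ> ?b) = 1"
      by (simp add: sign_compose permutation_swap_id sign_swap_id)
    have "T ((?a \<circ> ?b) (2 * j)) = T (2 * j)"
    proof (rule T_eq[OF permutes_compose[OF p(2,1)]])
      fix \<sigma>
      show "of_int (sign (?a \<circ> ?b)) * ?P (f \<circ> \<sigma> \<circ> (?a \<circ> ?b)) = ?P (f \<circ> \<sigma>)"
        unfolding sgn pair_prod_swap[OF that] by simp
    qed
    moreover have "(?a \<circ> ?b) (2 * j) = 0" by (auto simp: Transposition.transpose_def)
    ultimately show ?thesis by simp
  qed
  have odd: "T (Suc (2 * j)) = T 0" if "j < Suc k" for j
  proof -
    let ?a = "Transposition.transpose (2 * j) (Suc (2 * j))"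
    have p: "?a permutes {..<?m}" using that by (intro permutes_swap_id; auto)
    have "T (?a (2 * j)) = T (2 * j)"
    proof (rule T_eq[OF p])
      fix \<sigma> assume s: "\<sigma> permutes {..<?m}"
      have "\<sigma> (2 * j) < ?m" "\<sigma> (Suc (2 * j)) < ?m"
        using that permutes_in_image[OF s, of "2 * j"] permutes_in_image[OF s, of "Suc (2 * j)"]
        by auto
      then have "?P (f \<circ> \<sigma> \<circ> ?a) = - ?P (f \<circ> \<sigma>)"
        by (intro pair_prod_flip[OF that]) (unfold o_apply, rule anti)
      then show "of_int (sign ?a) * ?P (f \<circ> \<sigma> \<circ> ?a) = ?P (f \<circ> \<sigma>)"
        by (simp add: sign_swap_id)
    qed
    then show ?thesis using even[OF that] by simp
  qed
  have all: "T i = T 0" if "i < ?m" for i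
  proof (cases "even i")
    case True then show ?thesis using even[of "i div 2"] that by auto
  next
    case False then show ?thesis using odd[of "i div 2"] that by (auto elim!: oddE)
  qed
  have "altf ?m ?P f = (\<Sum>\<sigma> | \<sigma> permutes {..<?m}. \<Sum>i<?m.
      if \<sigma> i = 0 then of_int (sign \<sigma>) * ?P (f \<circ> \<sigma>) else 0)"
    unfolding altf_def
  proof (intro sum.cong refl)
    fix \<sigma> assume "\<sigma> \<in> {\<sigma>. \<sigma> permutes {..<?m}}"
    then have s: "\<sigma> permutes {..<?m}" by simp
    have "(\<sigma> i = 0) = (i = inv \<sigma> 0)" for i using permutes_inverses[OF s] by metis
    moreover have "inv \<sigma> 0 \<in> {..<?m}"
      using permutes_in_image[OF permutes_inv[OF s], of 0] by simp
    ultimately show "of_int (sign \<sigma>) * ?P (f \<circ> \<sigma>)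
      = (\<Sum>i<?m. if \<sigma> i = 0 then of_int (sign \<sigma>) * ?P (f \<circ> \<sigma>) else 0)"
      by (simp only: sum.delta finite_lessThan if_True)
  qed
  also have "\<dots> = (\<Sum>i<?m. T i)" unfolding T_def by (rule sum.swap)
  also have "\<dots> = (\<Sum>i<?m. T 0)" by (intro sum.cong refl all) simp
  also have "\<dots> = real ?m * T 0" by simp
  \<comment> \<open>With \<open>f 0\<close> in slot 0, the other \<open>2 * k + 1\<close> arguments
    are permuted freely, which is the sum on the right-hand side.\<close>
  also have "T 0 = (\<Sum>\<sigma> | \<sigma> permutes {..<Suc (Suc (2 * k))} \<and> \<sigma> 0 = 0. of_int (sign \<sigma>) * ?P (f \<circ> \<sigma>))"
  proof -
    have "T 0 = (\<Sum>\<sigma> \<in> {\<sigma> \<in> {\<sigma>. \<sigma> permutes {..<?m}}. \<sigma> 0 = 0}. of_int (sign \<sigma>) * ?P (f \<circ> \<sigma>))"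
      unfolding T_def by (rule sum.inter_filter[symmetric]) (simp add: finite_permutations)
    moreover have "{\<sigma> \<in> {\<sigma>. \<sigma> permutes {..<?m}}. \<sigma> 0 = 0}
      = {\<sigma>. \<sigma> permutes {..<Suc (Suc (2 * k))} \<and> \<sigma> 0 = 0}" by simp
    ultimately show ?thesis by (simp only:)
  qed
  also have "\<dots> = (\<Sum>\<tau> | \<tau> permutes {..<Suc (2 * k)}.
      of_int (sign (shift_perm 1 (Suc (2 * k)) \<tau>)) * ?P (f \<circ> shift_perm 1 (Suc (2 * k)) \<tau>))"
    by (rule sum.reindex_bij_betw[OF permutes_fixing_0, symmetric])
  also have "\<dots> = ?R"
    unfolding altf_def
  proof (intro sum.cong refl)
    fix \<tau> assume "\<tau> \<in> {\<tau>. \<tau> permutes {..<Suc (2 * k)}}"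
    then have t: "\<tau> permutes {..<Suc (2 * k)}" by simp
    have "?P (f \<circ> shift_perm 1 (Suc (2 * k)) \<tau>)
      = w (f 0) (f (1 + \<tau> 0)) * pair_prod w k (\<lambda>j. f (1 + \<tau> (1 + j)))"
      using shift_perm_high[OF t, of 1 0] shift_perm_high[OF t, of 1 "1 + j" for j]
      by (simp add: pair_prod_Suc shift_perm_low o_def)
    then show "of_int (sign (shift_perm 1 (Suc (2 * k)) \<tau>)) * ?P (f \<circ> shift_perm 1 (Suc (2 * k)) \<tau>)
      = of_int (sign \<tau>) * (w (f 0) (((\<lambda>j. f (1 + j)) \<circ> \<tau>) 0) *
          pair_prod w k (\<lambda>j. ((\<lambda>j. f (1 + j)) \<circ> \<tau>) (1 + j)))"
      by (simp add: sign_shift_perm[OF t])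
  qed
  finally show ?thesis .
qed

section \<open>Alternating forms on a finite-dimensional subspace\<close>

lemma ball_arguments_1: "(\<forall>xs \<in> arguments V (Suc 0). P xs) \<longleftrightarrow> (\<forall>x\<in>V. P [x])"
  by (auto simp: arguments_def length_Suc_conv)

lemma ball_arguments_2: "(\<forall>xs \<in> arguments V 2. P xs) \<longleftrightarrow> (\<forall>x\<in>V. \<forall>y\<in>V. P [x, y])"
  by (auto simp: arguments_def length_Suc_conv numeral_2_eq_2)

lemma ball_arguments_3: "(\<forall>xs \<in> arguments V 3. P xs) \<longleftrightarrow> (\<forall>x\<in>V. \<forall>y\<in>V. \<forall>z\<in>V. P [x, y, z])"
  by (auto simp: arguments_def length_Suc_conv numeral_3_eq_3)

lemma form_eq_1: "form_eq V 1 \<alpha> \<beta> \<longleftrightarrow> (\<forall>x\<in>V. \<alpha> [x] = \<beta> [x])"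
  by (simp add: form_eq_def ball_arguments_1)

lemma form_eq_2: "form_eq V 2 \<alpha> \<beta> \<longleftrightarrow> (\<forall>x\<in>V. \<forall>y\<in>V. \<alpha> [x, y] = \<beta> [x, y])"
  by (simp add: form_eq_def ball_arguments_2)

lemma form_eq_3: "form_eq V 3 \<alpha> \<beta> \<longleftrightarrow> (\<forall>x\<in>V. \<forall>y\<in>V. \<forall>z\<in>V. \<alpha> [x, y, z] = \<beta> [x, y, z])"
  by (simp add: form_eq_def ball_arguments_3)

lemma exterior_form_1: "exterior_form V 1 \<eta> \<longleftrightarrow> linear_within V (\<lambda>x. \<eta> [x])"
  by (auto simp: exterior_form_def ball_arguments_1 linear_within_def)

lemma exterior_form_2:
  "exterior_form V 2 \<omega> \<longleftrightarrow>
     (\<forall>x\<in>V. linear_within V (\<lambda>y. \<omega> [x, y]) \<and> linear_within V (\<lambda>y. \<omega> [y, x]) \<and> \<omega> [x, x] = 0)"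
proof -
  have "(\<forall>i<2. Q i) \<longleftrightarrow> Q 0 \<and> Q 1" for Q :: "nat \<Rightarrow> bool"
    by (auto simp: less_2_cases_iff)
  then show ?thesis
    by (auto simp: exterior_form_def ball_arguments_2)
qed

section \<open>Linear maps and dimension relative to a subspace\<close>

lemma linear_withinD:
  assumes "linear_within V f"
  shows "x \<in> V \<Longrightarrow> y \<in> V \<Longrightarrow> f (x + y) = f x + f y" and "x \<in> V \<Longrightarrow> f (c *\<^sub>R x) = c *\<^sub>R f x"
  using assms by (auto simp: linear_within_def)

lemma linear_within_0: "linear_within V f \<Longrightarrow> subspace V \<Longrightarrow> f 0 = 0"
  using linear_withinD(2)[of V f 0 0] by (simp add: subspace_0)

lemma linear_within_diff:
  assumes "linear_within V f" "subspace V" "x \<in> V" "y \<in> V"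
  shows "f (x - y) = f x - f y"
  using linear_withinD(1)[OF assms(1), of x "(-1) *\<^sub>R y"] linear_withinD(2)[OF assms(1,4), of "-1"] assms
  by (simp add: subspace_neg)

lemma linear_within_sum:
  assumes "linear_within V f" "subspace V" "finite A" "A \<subseteq> V"
  shows "f (\<Sum>v\<in>A. u v *\<^sub>R v) = (\<Sum>v\<in>A. u v *\<^sub>R f v)"
  using assms(3,4)
proof (induction A)
  case empty then show ?case using linear_within_0[OF assms(1,2)] by simp
next
  case (insert a A)
  have "(\<Sum>v\<in>A. u v *\<^sub>R v) \<in> V"
    using insert.prems assms(2) by (intro subspace_sum) (auto intro: subspace_scale)
  then show ?case
    using insert linear_withinD[OF assms(1)] assms(2) by (simp add: subspace_scale)
qed

lemma linear_within_subset: "linear_within V f \<Longrightarrow> W \<subseteq> V \<Longrightarrow> linear_within W f"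
  unfolding linear_within_def by blast

lemma linear_within_combination:
  fixes F :: "'i \<Rightarrow> 'a::real_vector \<Rightarrow> real"
  assumes "\<And>i. i \<in> I \<Longrightarrow> linear_within V (F i)"
  shows "linear_within V (\<lambda>x. \<Sum>i\<in>I. c i * F i x)"
  unfolding linear_within_def
proof (intro conjI ballI allI)
  fix x y assume "x \<in> V" "y \<in> V"
  then have "(\<Sum>i\<in>I. c i * F i (x + y)) = (\<Sum>i\<in>I. c i * F i x + c i * F i y)"
    by (intro sum.cong refl) (simp add: linear_withinD(1)[OF assms] distrib_left)
  then show "(\<Sum>i\<in>I. c i * F i (x + y)) = (\<Sum>i\<in>I. c i * F i x) + (\<Sum>i\<in>I. c i * F i y)"
    by (simp add: sum.distrib)
next
  fix x and r :: real assume "x \<in> V"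
  then have "(\<Sum>i\<in>I. c i * F i (r *\<^sub>R x)) = (\<Sum>i\<in>I. r * (c i * F i x))"
    by (intro sum.cong refl) (simp add: linear_withinD(2)[OF assms])
  then show "(\<Sum>i\<in>I. c i * F i (r *\<^sub>R x)) = r *\<^sub>R (\<Sum>i\<in>I. c i * F i x)"
    by (simp add: sum_distrib_left)
qed

text \<open>A vector of \<open>V\<close> outside \<open>span B\<close> would enlarge
  \<open>B\<close> to \<open>dim V + 1\<close> independent vectors in the span of a basis of
  \<open>V\<close>. The set \<open>S\<close> supplies finiteness, the ambient type being
  arbitrary.\<close>

lemma independent_spans_subspace:
  assumes "finite S" "V \<subseteq> span S" "B \<subseteq> V" "independent B" "card B = dim V"
  shows "V \<subseteq> span B"
proof
  fix v assume v: "v \<in> V"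
  obtain C where C: "C \<subseteq> V" "independent C" "V \<subseteq> span C" "card C = dim V"
    using basis_exists by blast
  have fin: "finite C" "finite B"
    using independent_span_bound[OF assms(1)] C assms by auto
  show "v \<in> span B"
  proof (rule ccontr)
    assume nv: "v \<notin> span B"
    then have "v \<notin> B" using span_base by auto
    have "independent (insert v B)" using assms(4) nv by (simp add: independent_insert)
    then have "card (insert v B) \<le> card C"
      using independent_span_bound[OF fin(1)] C assms(3) v by blast
    then show False using \<open>v \<notin> B\<close> fin assms(5) C(4) by simp
  qed
qed

section \<open>Nonzero values of top-degree forms\<close>

lemma form_repeated:
  assumes "exterior_form V m \<omega>" "xs \<in> arguments V m" "i < m" "j < m" "i \<noteq> j" "xs ! i = xs ! j"
  shows "\<omega> xs = 0"
  using assms by (auto simp: exterior_form_def)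

lemma form_linear:
  assumes "exterior_form V m \<omega>" "xs \<in> arguments V m" "i < m"
  shows "linear_within V (\<lambda>x. \<omega> (xs[i := x]))"
  using assms by (auto simp: exterior_form_def)

lemma arguments_update: "xs \<in> arguments V m \<Longrightarrow> x \<in> V \<Longrightarrow> xs[i := x] \<in> arguments V m"
  using set_update_subset_insert[of xs i x] by (auto simp: arguments_def)

lemma arguments_nth: "xs \<in> arguments V m \<Longrightarrow> i < m \<Longrightarrow> xs ! i \<in> V"
  by (auto simp: arguments_def)

text \<open>If an entry were a combination of the others, expanding it there would give only terms
  with a repeated entry, hence the value 0. So the entries are independent, and there are
  \<open>dim V\<close> of them.\<close>

lemma nonzero_form_basis:
  assumes V: "subspace V" and S: "finite S" "V \<subseteq> span S"
    and \<omega>: "exterior_form V (dim V) \<omega>" and xs: "xs \<in> arguments V (dim V)" "\<omega> xs \<noteq> 0"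
  shows "V \<subseteq> span (set xs)"
proof -
  let ?m = "dim V"
  have len: "length xs = ?m" and sub: "set xs \<subseteq> V" using xs(1) by (auto simp: arguments_def)
  have dist: "distinct xs"
    using form_repeated[OF \<omega> xs(1)] xs(2) len by (auto simp: distinct_conv_nth)
  have "independent (set xs)"
  proof
    assume "dependent (set xs)"
    then obtain a where a: "a \<in> set xs" "a \<in> span (set xs - {a})" by (auto simp: dependent_def)
    then obtain u where u: "a = (\<Sum>v\<in>set xs - {a}. u v *\<^sub>R v)"
      by (auto simp: span_finite)
    obtain i where i: "i < ?m" "xs ! i = a" using a(1) len by (auto simp: in_set_conv_nth)
    have "\<omega> xs = \<omega> (xs[i := a])" using i by auto
    also have "\<dots> = (\<Sum>v\<in>set xs - {a}. u v *\<^sub>R \<omega> (xs[i := v]))"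
      using linear_within_sum[OF form_linear[OF \<omega> xs(1) i(1)] V, of "set xs - {a}" u] sub u
      by auto
    also have "\<dots> = 0"
    proof (rule sum.neutral, rule ballI)
      fix v assume v: "v \<in> set xs - {a}"
      then obtain j where j: "j < ?m" "xs ! j = v" using len by (auto simp: in_set_conv_nth)
      then have "\<omega> (xs[i := v]) = 0"
        using v sub i len
        by (intro form_repeated[OF \<omega> arguments_update[OF xs(1)], of _ i j]) (auto simp: nth_list_update)
      then show "u v *\<^sub>R \<omega> (xs[i := v]) = 0" by simp
    qed
    finally show False using xs(2) by simp
  qed
  then show "V \<subseteq> span (set xs)"
    using independent_spans_subspace[OF S sub] distinct_card[OF dist] len by simp
qed

text \<open>Expand \<open>X\<close> in the basis formed by \<open>xs\<close> and pick an entry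
  \<open>a\<close> with nonzero coefficient \<open>u a\<close>. Putting \<open>X\<close> in the
  place of \<open>a\<close> multiplies the value by \<open>u a\<close>, since all other terms repeat
  an entry.\<close>

lemma nonzero_form_replace:
  assumes V: "subspace V" and S: "finite S" "V \<subseteq> span S"
    and \<omega>: "exterior_form V (dim V) \<omega>" and xs: "xs \<in> arguments V (dim V)" "\<omega> xs \<noteq> 0"
    and X: "X \<in> V" "X \<noteq> 0"
  obtains i where "i < dim V" "\<omega> (xs[i := X]) \<noteq> 0"
proof -
  let ?m = "dim V"
  have len: "length xs = ?m" and sub: "set xs \<subseteq> V" using xs(1) by (auto simp: arguments_def)
  have "X \<in> span (set xs)" using nonzero_form_basis[OF V S \<omega> xs] X(1) by auto
  then obtain u where u: "X = (\<Sum>v\<in>set xs. u v *\<^sub>R v)" by (auto simp: span_finite)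
  then obtain a where a: "a \<in> set xs" "u a \<noteq> 0"
    using X(2) by (metis (mono_tags, lifting) scale_zero_left sum.neutral)
  obtain i where i: "i < ?m" "xs ! i = a" using a(1) len by (auto simp: in_set_conv_nth)
  have "\<omega> (xs[i := X]) = (\<Sum>v\<in>set xs. u v * \<omega> (xs[i := v]))"
    using linear_within_sum[OF form_linear[OF \<omega> xs(1) i(1)] V, of "set xs" u] sub u by simp
  also have "\<dots> = (\<Sum>v\<in>set xs. if v = a then u a * \<omega> xs else 0)"
  proof (intro sum.cong refl)
    fix v assume v: "v \<in> set xs"
    then obtain j where j: "j < ?m" "xs ! j = v" using len by (auto simp: in_set_conv_nth)
    show "u v * \<omega> (xs[i := v]) = (if v = a then u a * \<omega> xs else 0)"
    proof (cases "v = a")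
      case True then show ?thesis using i by (auto simp: list_update_same_conv)
    next
      case False
      then have "\<omega> (xs[i := v]) = 0"
        using v sub i j len
        by (intro form_repeated[OF \<omega> arguments_update[OF xs(1)], of _ i j]) (auto simp: nth_list_update)
      then show ?thesis using False by simp
    qed
  qed
  also have "\<dots> = u a * \<omega> xs" using a(1) by simp
  finally show ?thesis using that[OF i(1)] a(2) xs(2) by simp
qed

text \<open>Polarisation: expand the vanishing value with \<open>a + b\<close> in both positions.
  Antisymmetry has to be derived, as forms are required only to vanish on repeated entries.\<close>

lemma form_swap:
  assumes V: "subspace V" and \<omega>: "exterior_form V m \<omega>" and xs: "xs \<in> arguments V m"
    and ij: "i < m" "j < m" "i \<noteq> j" and ab: "a \<in> V" "b \<in> V"
  shows "\<omega> (xs[i := a, j := b]) = - \<omega> (xs[i := b, j := a])"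
proof -
  define L where "L a b = \<omega> (xs[i := a, j := b])" for a b
  have len: "length xs = m" using xs by (auto simp: arguments_def)
  have L1: "L (a + c) b = L a b + L c b" if "a \<in> V" "b \<in> V" "c \<in> V" for a b c
  proof -
    have "L x b = \<omega> (xs[j := b, i := x])" for x
      by (simp add: L_def list_update_swap[OF ij(3), of xs x b])
    then show ?thesis
      using linear_withinD(1)[OF form_linear[OF \<omega> arguments_update[OF xs that(2)] ij(1)] that(1,3)]
      by simp
  qed
  have L2: "L a (b + c) = L a b + L a c" if "a \<in> V" "b \<in> V" "c \<in> V" for a b c
    using linear_withinD(1)[OF form_linear[OF \<omega> arguments_update[OF xs that(1)] ij(2)] that(2,3)]
    by (simp add: L_def)
  have L0: "L a a = 0" if "a \<in> V" for a
    unfolding L_def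
    by (rule form_repeated[OF \<omega> _ ij]) (use that xs len ij in \<open>auto intro!: arguments_update\<close>)
  have "L (a + b) (a + b) = L a a + L a b + (L b a + L b b)"
    using ab V by (simp add: L1 L2 subspace_add)
  then have "L a b = - L b a" using L0 ab V by (simp add: subspace_add)
  then show ?thesis by (simp add: L_def)
qed

text \<open>Contraction fills the first slot, so the inserted vector is moved there by exchanging
  positions 0 and \<open>i\<close>, at the cost of a sign.\<close>

lemma nonzero_form_head:
  assumes V: "subspace V" and \<omega>: "exterior_form V m \<omega>" and xs: "xs \<in> arguments V m"
    and i: "i < m" and X: "X \<in> V" and nz: "\<omega> (xs[i := X]) \<noteq> 0"
  obtains ys where "ys \<in> arguments V (m - 1)" "\<omega> (X # ys) \<noteq> 0"
proof -
  obtain x0 xs' where x0: "xs = x0 # xs'" using xs i by (cases xs) (auto simp: arguments_def)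
  have "\<exists>zs. zs \<in> arguments V (m - 1) \<and> \<omega> (X # zs) \<noteq> 0"
  proof (cases i)
    case 0 then show ?thesis using x0 nz xs by (intro exI[of _ xs']) (auto simp: arguments_def)
  next
    case (Suc k)
    have x0V: "x0 \<in> V" using xs x0 by (auto simp: arguments_def)
    have "\<omega> (xs[0 := x0, i := X]) = - \<omega> (xs[0 := X, i := x0])"
      by (rule form_swap[OF V \<omega> xs _ i _ x0V X]) (use i Suc in auto)
    then have "\<omega> (X # xs'[k := x0]) \<noteq> 0" using nz x0 Suc by simp
    moreover have "xs'[k := x0] \<in> arguments V (m - 1)"
      using xs x0 x0V set_update_subset_insert[of xs' k x0] by (auto simp: arguments_def)
    ultimately show ?thesis by blast
  qed
  then show ?thesis using that by blast
qed

text \<open>Once \<open>X\<close> is an argument, changing the others by multiples of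
  \<open>X\<close> only adds terms with \<open>X\<close> repeated. In the induction the prefix
  \<open>as\<close> accumulates the entries already projected.\<close>

lemma form_project:
  assumes V: "subspace V" and \<omega>: "exterior_form V (Suc m) \<omega>" and X: "X \<in> V"
    and "as @ ys \<in> arguments V m"
    and "\<And>y. y \<in> V \<Longrightarrow> y - c y *\<^sub>R X \<in> V"
  shows "\<omega> (X # as @ map (\<lambda>y. y - c y *\<^sub>R X) ys) = \<omega> (X # as @ ys)"
  using assms(4)
proof (induction ys arbitrary: as)
  case Nil then show ?case by simp
next
  case (Cons y ys)
  have y: "y \<in> V" using Cons.prems by (auto simp: arguments_def)
  let ?l = "X # as @ y # ys" and ?i = "Suc (length as)"
  have l: "?l \<in> arguments V (Suc m)" "?i < Suc m" using Cons.prems X by (auto simp: arguments_def)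
  have upd: "?l[?i := z] = X # as @ z # ys" for z by (simp add: list_update_append)
  have "\<omega> (X # as @ map (\<lambda>y. y - c y *\<^sub>R X) (y # ys))
    = \<omega> (X # (as @ [y - c y *\<^sub>R X]) @ map (\<lambda>y. y - c y *\<^sub>R X) ys)" by simp
  also have "\<dots> = \<omega> (X # (as @ [y - c y *\<^sub>R X]) @ ys)"
    using Cons.prems assms(5)[OF y] by (intro Cons.IH) (auto simp: arguments_def)
  also have "\<dots> = \<omega> (?l[?i := y - c y *\<^sub>R X])" by (simp add: list_update_append)
  also have "\<dots> = \<omega> (?l[?i := y]) - c y *\<^sub>R \<omega> (?l[?i := X])"
    using linear_within_diff[OF form_linear[OF \<omega> l] V y subspace_scale[OF V X]]
      linear_withinD(2)[OF form_linear[OF \<omega> l] X] by simp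
  also have "\<omega> (?l[?i := X]) = 0"
    by (rule form_repeated[OF \<omega> arguments_update[OF l(1) X], of 0 ?i])
      (use l in \<open>auto simp: nth_append list_update_append\<close>)
  finally show ?case by (simp add: upd)
qed

text \<open>Nondegeneracy makes \<open>x \<mapsto> w x\<close> injective, and equality of dimensions
  makes it surjective onto the functionals. To stay inside \<open>V\<close>, a functional is encoded
  by the vector whose coordinates are its values on a basis \<open>B\<close>.\<close>

lemma nondegenerate_represents:
  fixes V :: "'a::real_vector set"
  assumes V: "subspace V" and S: "finite S" "V \<subseteq> span S"
    and w: "\<And>x. x \<in> V \<Longrightarrow> linear_within V (w x)" "\<And>y. y \<in> V \<Longrightarrow> linear_within V (\<lambda>x. w x y)"
    and nd: "\<And>x. x \<in> V \<Longrightarrow> \<forall>y\<in>V. w x y = (0::real) \<Longrightarrow> x = 0"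
    and l: "linear_within V l"
  obtains U where "U \<in> V" "\<And>y. y \<in> V \<Longrightarrow> w U y = l y"
proof -
  obtain B where B: "B \<subseteq> V" "independent B" "V \<subseteq> span B" "card B = dim V"
    using basis_exists by blast
  have fB: "finite B" using independent_span_bound[OF S(1) B(2)] B(1) S(2) by auto
  have spB: "span B = V" using B V by (simp add: span_minimal subset_antisym)
  have on_V: "f y = h y" if "linear_within V f" "linear_within V h" "\<And>b. b \<in> B \<Longrightarrow> f b = h b" and y: "y \<in> V"
    for f h :: "'a \<Rightarrow> 'c::real_vector" and y
  proof -
    obtain u where "y = (\<Sum>v\<in>B. u v *\<^sub>R v)" using y spB span_finite[OF fB] by auto
    then show ?thesis
      using linear_within_sum[OF that(1) V fB B(1), of u] linear_within_sum[OF that(2) V fB B(1), of u] that(3)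
      by simp
  qed
  define T where "T x = (\<Sum>b\<in>B. w x b *\<^sub>R b)" for x
  have T_lin: "linear_within V T"
    unfolding linear_within_def T_def scaleR_sum_right sum.distrib[symmetric]
    using linear_withinD[OF w(2)] B(1)
    by (auto simp: scaleR_add_left[symmetric] subset_iff intro!: sum.cong)
  \<comment> \<open>\<open>T\<close> is linear only on \<open>V\<close>. The map \<open>g\<close>
    extends it from \<open>B\<close> to the whole type, so that the theorems on images under
    globally linear maps apply.\<close>
  obtain g where g: "linear g" "\<And>b. b \<in> B \<Longrightarrow> g b = T b"
    using linear_independent_extend[OF B(2), of T] by auto
  have gT: "g x = T x" if "x \<in> V" for x
    by (rule on_V[OF _ T_lin g(2) that]) (simp_all add: linear_within_def linear_add[OF g(1)] linear_scale[OF g(1)])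
  have coeff: "u = v" if "(\<Sum>b\<in>B. u b *\<^sub>R b) = (\<Sum>b\<in>B. v b *\<^sub>R b)" "\<And>b. b \<notin> B \<Longrightarrow> u b = v b" for u v
  proof
    fix b
    have "(\<Sum>b\<in>B. (u b - v b) *\<^sub>R b) = 0" using that(1) by (simp add: scaleR_diff_left sum_subtractf)
    then have "b \<in> B \<Longrightarrow> u b - v b = 0" using independentD[OF B(2) fB, of "\<lambda>b. u b - v b"] by auto
    then show "u b = v b" using that(2) by fastforce
  qed
  have Tw: "w x b = u b" if "T x = (\<Sum>b\<in>B. u b *\<^sub>R b)" "b \<in> B" for x u b
    using coeff[of "\<lambda>b. if b \<in> B then w x b else 0" "\<lambda>b. if b \<in> B then u b else 0"] that
    by (auto simp: T_def fun_eq_iff split: if_splits)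
  have TV: "T x \<in> V" if "x \<in> V" for x
    unfolding T_def using B(1) V by (intro subspace_sum) (auto intro: subspace_scale)
  have "inj_on g (span B)"
  proof (subst linear_inj_on_iff_eq_0[OF g(1)])
    show "subspace (span B)" by simp
    show "\<forall>v\<in>span B. g v = 0 \<longrightarrow> v = 0"
    proof (intro ballI impI)
      fix x assume x: "x \<in> span B" "g x = 0"
      then have "T x = (\<Sum>b\<in>B. 0 *\<^sub>R b)" using gT spB by simp
      then have "\<And>b. b \<in> B \<Longrightarrow> w x b = 0" using Tw[of x "\<lambda>_. 0"] by simp
      then have "\<forall>y\<in>V. w x y = 0" using on_V[OF w(1), of x "\<lambda>_. 0"] x spB by (auto simp: linear_within_def)
      then show "x = 0" using nd x spB by auto
    qed
  qed
  then have "independent (g ` B)" "inj_on g B"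
    using linear_independent_injective_image[OF g(1) B(2)] span_superset inj_on_subset by (blast, blast)
  moreover have "g ` B \<subseteq> V" using gT TV B(1) by auto
  ultimately have "V \<subseteq> span (g ` B)"
    using independent_spans_subspace[OF S, of "g ` B"] B(4) card_image by metis
  then have gV: "V \<subseteq> g ` V" using linear_span_image[OF g(1), of B] spB by simp
  have "(\<Sum>b\<in>B. l b *\<^sub>R b) \<in> V" using B(1) V by (intro subspace_sum) (auto intro: subspace_scale)
  \<comment> \<open>The target encodes the functional \<open>l\<close>; equality of coordinates,
    \<open>Tw\<close>, then gives \<open>w U b = l b\<close> on the basis.\<close>
  then obtain U where U: "U \<in> V" "T U = (\<Sum>b\<in>B. l b *\<^sub>R b)" using gV gT by force
  show ?thesis
    by (rule that[OF U(1)]) (rule on_V[OF w(1)[OF U(1)] l Tw[OF U(2)]])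
qed

section \<open>Wedge powers of a 2-form\<close>

lemma pair_prod_cong:
  "(\<And>i. i < 2 * k \<Longrightarrow> f i = g i) \<Longrightarrow> pair_prod w k f = pair_prod w k g"
  unfolding pair_prod_def by (intro prod.cong refl) auto

text \<open>By \<open>altf_altf\<close> the antisymmetrisation inside \<beta> yields a factor
  \<open>q!\<close>, which cancels the \<open>q!\<close> of the wedge normalisation and leaves
  \<open>1 / p!\<close>.\<close>

lemma wedge_altf:
  assumes \<beta>: "\<And>xs. \<beta> xs = d * altf q P ((!) xs)"
    and P: "\<And>f g. (\<And>i. i < q \<Longrightarrow> f i = g i) \<Longrightarrow> P f = P g"
  shows "wedge p q \<alpha> \<beta> xs
    = d / fact p * altf (p + q) (\<lambda>f. \<alpha> (map f [0..<p]) * P (\<lambda>j. f (p + j))) ((!) xs)"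
proof -
  let ?A = "\<lambda>f. \<alpha> (map f [0..<p])"
  have "wedge p q \<alpha> \<beta> xs
    = altf (p + q) (\<lambda>f. ?A f * \<beta> (map f [p..<p + q])) ((!) xs) / (fact p * fact q)"
    by (simp add: wedge_def altf_def o_def mult.assoc)
  also have "altf (p + q) (\<lambda>f. ?A f * \<beta> (map f [p..<p + q])) ((!) xs)
    = altf (p + q) (\<lambda>f. d * (?A f * altf q P (\<lambda>j. f (p + j)))) ((!) xs)"
  proof (rule altf_cong)
    fix f g :: "nat \<Rightarrow> 'a" assume fg: "\<And>i. i < p + q \<Longrightarrow> f i = g i"
    have "altf q P ((!) (map f [p..<p + q])) = altf q P (\<lambda>j. g (p + j))"
      by (rule altf_cong) (simp add: fg, rule P, simp)
    moreover have "?A f = ?A g" using fg by (intro arg_cong[where f = \<alpha>]) auto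
    ultimately show "?A f * \<beta> (map f [p..<p + q]) = d * (?A g * altf q P (\<lambda>j. g (p + j)))"
      by (simp add: \<beta>)
  qed simp
  also have "\<dots> = d * (fact q * altf (p + q) (\<lambda>f. ?A f * P (\<lambda>j. f (p + j))) ((!) xs))"
    unfolding altf_scale
    by (subst altf_altf) (auto intro!: arg_cong[where f = \<alpha>])
  finally show ?thesis by simp
qed

text \<open>Each further 2-form contributes the normalisation \<open>1 / 2!\<close>, whence
  \<open>1 / 2 ^ k\<close>.\<close>

lemma wedge_power_altf:
  "wedge_power 2 \<omega> k xs = (1 / 2 ^ k) * altf (2 * k) (pair_prod (\<lambda>x y. \<omega> [x, y]) k) ((!) xs)"
proof (induction k arbitrary: xs)
  case 0
  have "{\<sigma>. \<sigma> permutes {..<0::nat}} = {id}" by auto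
  then show ?case by (simp add: altf_def pair_prod_def)
next
  case (Suc k)
  have "wedge_power 2 \<omega> (Suc k) xs = (1 / 2 ^ k) / fact 2 * altf (2 + 2 * k)
      (\<lambda>f. \<omega> (map f [0..<2]) * pair_prod (\<lambda>x y. \<omega> [x, y]) k (\<lambda>j. f (2 + j))) ((!) xs)"
    unfolding wedge_power.simps
    by (rule wedge_altf[OF Suc.IH]) (rule pair_prod_cong)
  then show ?case
    by (simp add: pair_prod_Suc[abs_def] upt_rec[of 0] upt_rec[of 1] numeral_2_eq_2)
qed

lemma wedge_1_power_altf:
  "wedge 1 (2 * k) \<eta> (wedge_power 2 \<omega> k) xs = (1 / 2 ^ k) *
    altf (Suc (2 * k)) (\<lambda>g. \<eta> [g 0] * pair_prod (\<lambda>x y. \<omega> [x, y]) k (\<lambda>j. g (1 + j))) ((!) xs)"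
  using wedge_altf[OF wedge_power_altf pair_prod_cong, where p = 1 and \<alpha> = \<eta> and xs = xs] by simp

lemma altf_cong_on:
  assumes "\<And>i. i < m \<Longrightarrow> f i \<in> V"
    and "\<And>g. (\<And>i. i < m \<Longrightarrow> g i \<in> V) \<Longrightarrow> P g = Q g"
  shows "altf m P f = altf m Q f"
  unfolding altf_def
proof (intro sum.cong refl arg_cong2[where f = "(*)"] assms(2))
  fix \<sigma> i assume "\<sigma> \<in> {\<sigma>. \<sigma> permutes {..<m}}" "i < m"
  then have "\<sigma> i < m" using permutes_in_image[of \<sigma> "{..<m}" i] by auto
  then show "(f \<circ> \<sigma>) i \<in> V" using assms(1) by simp
qed

lemma form_antisym:
  assumes "subspace V" "exterior_form V 2 \<omega>" "x \<in> V" "y \<in> V"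
  shows "\<omega> [x, y] = - \<omega> [y, x]"
  using form_swap[OF assms(1,2), of "[x, y]" 0 1 x y] assms(3,4) by (simp add: arguments_def)

text \<open>The contraction identity in the form that serves both directions, with \<open>H\<close>
  the kernel of the Lee form and \<open>\<omega>'\<close> in the role of \<open>d\<eta>\<close>,
  which has to agree with \<omega> only on \<open>H\<close>. The \<open>2 * (k + 1)\<close> slots
  for \<open>U\<close> against the normalisations \<open>1 / 2 ^ (k + 1)\<close> and
  \<open>1 / 2 ^ k\<close> leave the factor \<open>k + 1\<close>; the sign is that of
  \<open>\<eta> = - \<iota>\<^sub>U \<omega>\<close>.\<close>

lemma wedge_power_contract:
  assumes V: "subspace V" and \<omega>: "exterior_form V 2 \<omega>" and U: "U \<in> V" and H: "H \<subseteq> V"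
    and \<eta>: "\<And>y. y \<in> H \<Longrightarrow> \<eta> [y] = - \<omega> [U, y]"
    and \<omega>': "\<And>x y. x \<in> H \<Longrightarrow> y \<in> H \<Longrightarrow> \<omega>' [x, y] = \<omega> [x, y]"
    and ys: "ys \<in> arguments H (Suc (2 * k))"
  shows "wedge_power 2 \<omega> (Suc k) (U # ys)
    = - real (Suc k) * wedge 1 (2 * k) \<eta> (wedge_power 2 \<omega>' k) ys"
proof -
  let ?w = "\<lambda>x y. \<omega> [x, y]"
  have in_V: "(U # ys) ! i \<in> V" if "i < 2 * Suc k" for i
    using that ys U H nth_mem[of i "U # ys"] by (auto simp: arguments_def simp del: nth_mem)
  have "altf (2 * Suc k) (pair_prod ?w (Suc k)) ((!) (U # ys))
    = real (2 * Suc k) * altf (Suc (2 * k)) (\<lambda>g. \<omega> [U, g 0] * pair_prod ?w k (\<lambda>j. g (1 + j))) ((!) ys)"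
    using altf_pair_prod_contract[where w = ?w and f = "(!) (U # ys)" and k = k,
        OF form_antisym[OF V \<omega> in_V in_V]] by simp
  also have "altf (Suc (2 * k)) (\<lambda>g. \<omega> [U, g 0] * pair_prod ?w k (\<lambda>j. g (1 + j))) ((!) ys)
    = altf (Suc (2 * k)) (\<lambda>g. - 1 * (\<eta> [g 0] * pair_prod (\<lambda>x y. \<omega>' [x, y]) k (\<lambda>j. g (1 + j)))) ((!) ys)"
  proof (rule altf_cong_on[where V = H])
    show "ys ! i \<in> H" if "i < Suc (2 * k)" for i using arguments_nth[OF ys that] .
  next
    fix g assume g: "\<And>i. i < Suc (2 * k) \<Longrightarrow> g i \<in> H"
    have "pair_prod (\<lambda>x y. \<omega>' [x, y]) k (\<lambda>j. g (1 + j)) = pair_prod ?w k (\<lambda>j. g (1 + j))"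
      unfolding pair_prod_def by (intro prod.cong refl \<omega>' g) auto
    then show "\<omega> [U, g 0] * pair_prod ?w k (\<lambda>j. g (1 + j))
      = - 1 * (\<eta> [g 0] * pair_prod (\<lambda>x y. \<omega>' [x, y]) k (\<lambda>j. g (1 + j)))"
      using \<eta>[OF g[of 0]] by simp
  qed
  finally show ?thesis
    unfolding wedge_power_altf wedge_1_power_altf altf_scale by (simp add: field_simps)
qed

text \<open>Slot \<open>i\<close> occurs in factor \<open>i div 2\<close> only, as its first or
  second argument according to parity; the remaining factors form the constant
  \<open>c\<close>.\<close>

lemma pair_prod_linear:
  assumes V: "\<And>l. l < 2 * k \<Longrightarrow> f l \<in> V" and i: "i < 2 * k"
    and w: "\<And>x. x \<in> V \<Longrightarrow> linear_within V (w x)" "\<And>y. y \<in> V \<Longrightarrow> linear_within V (\<lambda>x. w x y)"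
  shows "linear_within V (\<lambda>x. pair_prod w k (f(i := x)))"
proof -
  let ?j = "i div 2"
  define c where "c = (\<Prod>l\<in>{..<k} - {?j}. w (f (2 * l)) (f (Suc (2 * l))))"
  define h where "h x = w ((f(i := x)) (2 * ?j)) ((f(i := x)) (Suc (2 * ?j)))" for x
  have j: "?j < k" using i by auto
  have fV: "f (2 * ?j) \<in> V" "f (Suc (2 * ?j)) \<in> V" using j by (auto intro!: V)
  have "pair_prod w k (f(i := x)) = h x * c" for x
    unfolding pair_prod_def h_def c_def using j
    by (subst prod.remove[of _ ?j]) (auto intro!: prod.cong arg_cong2[where f = w])
  moreover have "linear_within V h"
  proof (cases "even i")
    case True
    then have "h = (\<lambda>x. w x (f (Suc (2 * ?j))))" by (auto simp: h_def fun_eq_iff)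
    then show ?thesis using w(2)[OF fV(2)] by simp
  next
    case False
    then have "h = w (f (2 * ?j))" by (auto simp: h_def fun_eq_iff elim!: oddE)
    then show ?thesis using w(1)[OF fV(1)] by simp
  qed
  ultimately show ?thesis by (simp add: linear_within_def algebra_simps)
qed

text \<open>After permuting by \<sigma>, position \<open>i\<close> of the list is read in slot
  \<open>inv \<sigma> i\<close>; so each term of the alternating sum varies in exactly one
  slot.\<close>

lemma list_update_comp_permutation:
  assumes s: "\<sigma> permutes {..<m}" and i: "i < m" and len: "length xs = m" and l: "l < m"
  shows "((!) (xs[i := x]) \<circ> \<sigma>) l = (((!) xs \<circ> \<sigma>)(inv \<sigma> i := x)) l"
proof -
  have "\<sigma> l < m" using permutes_in_image[OF s, of l] l by simp
  moreover have "(\<sigma> l = i) = (l = inv \<sigma> i)" using permutes_inverses[OF s] by metis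
  ultimately show ?thesis using len by (auto simp: nth_list_update)
qed

lemma exterior_form_wedge_power:
  fixes V :: "'a::real_vector set"
  assumes \<omega>: "exterior_form V 2 \<omega>"
  shows "exterior_form V (2 * k) (wedge_power 2 \<omega> k)"
  unfolding exterior_form_def
proof (intro conjI ballI allI impI)
  fix xs i assume xs: "xs \<in> arguments V (2 * k)" and i: "i < 2 * k"
  let ?w = "\<lambda>x y. \<omega> [x, y]"
  let ?F = "\<lambda>\<sigma> x. pair_prod ?w k (((!) xs \<circ> \<sigma>)(inv \<sigma> i := x))"
  have "wedge_power 2 \<omega> k (xs[i := x])
    = (\<Sum>\<sigma> | \<sigma> permutes {..<2 * k}. (1 / 2 ^ k * of_int (sign \<sigma>)) * ?F \<sigma> x)" for x
    unfolding wedge_power_altf altf_def sum_distrib_left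
  proof (intro sum.cong refl)
    fix \<sigma> assume "\<sigma> \<in> {\<sigma>. \<sigma> permutes {..<2 * k}}"
    then have s: "\<sigma> permutes {..<2 * k}" by simp
    have "pair_prod ?w k ((!) (xs[i := x]) \<circ> \<sigma>) = ?F \<sigma> x"
      by (rule pair_prod_cong, rule list_update_comp_permutation[OF s i])
        (use xs in \<open>auto simp: arguments_def\<close>)
    then show "1 / 2 ^ k * (of_int (sign \<sigma>) * pair_prod ?w k ((!) (xs[i := x]) \<circ> \<sigma>))
      = (1 / 2 ^ k * of_int (sign \<sigma>)) * ?F \<sigma> x"
      by (simp only: mult.assoc)
  qed
  moreover have "linear_within V (\<lambda>x. \<Sum>\<sigma> | \<sigma> permutes {..<2 * k}.
      (1 / 2 ^ k * of_int (sign \<sigma>)) * ?F \<sigma> x)"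
  proof (rule linear_within_combination, rule pair_prod_linear)
    fix \<sigma> l assume "\<sigma> \<in> {\<sigma>. \<sigma> permutes {..<2 * k}}"
    then have s: "\<sigma> permutes {..<2 * k}" by simp
    show "inv \<sigma> i < 2 * k" using permutes_in_image[OF permutes_inv[OF s], of i] i by simp
    assume "l < 2 * k"
    then have "\<sigma> l < 2 * k" using permutes_in_image[OF s, of l] by simp
    then show "((!) xs \<circ> \<sigma>) l \<in> V" using arguments_nth[OF xs] by simp
  qed (use \<omega> in \<open>auto simp: exterior_form_2\<close>)
  ultimately show "linear_within V (\<lambda>x. wedge_power 2 \<omega> k (xs[i := x]))" by simp
next
  fix xs :: "'a list" and i j assume "i < 2 * k" "j < 2 * k" "i \<noteq> j" "xs ! i = xs ! j"
  then show "wedge_power 2 \<omega> k xs = 0"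
    by (simp add: wedge_power_altf altf_repeated[of i "2 * k" j])
qed

text \<open>In the term of \<sigma> the radical vector sits in slot \<open>inv \<sigma> i\<close>,
  so the factor numbered \<open>inv \<sigma> i div 2\<close> vanishes. Hence every term
  does.\<close>

lemma wedge_power_radical:
  assumes xs: "xs \<in> arguments V (2 * k)" and i: "i < 2 * k"
    and X: "\<And>y. y \<in> V \<Longrightarrow> \<omega> [xs ! i, y] = 0 \<and> \<omega> [y, xs ! i] = 0"
  shows "wedge_power 2 \<omega> k xs = 0"
proof -
  have "pair_prod (\<lambda>x y. \<omega> [x, y]) k ((!) xs \<circ> \<sigma>) = 0" if s: "\<sigma> permutes {..<2 * k}" for \<sigma>
    unfolding pair_prod_def
  proof (rule prod_zero)
    let ?l = "inv \<sigma> i" and ?j = "inv \<sigma> i div 2"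
    have l: "?l < 2 * k" using permutes_in_image[OF permutes_inv[OF s], of i] i by simp
    have sl: "\<sigma> ?l = i" using permutes_inverses[OF s] by simp
    have V: "xs ! \<sigma> a \<in> V" if "a < 2 * k" for a
      using permutes_in_image[OF s, of a] that arguments_nth[OF xs] by simp
    have j: "2 * ?j < 2 * k" "Suc (2 * ?j) < 2 * k" using l by presburger+
    have "?l = 2 * ?j \<or> ?l = Suc (2 * ?j)" by presburger
    then have "\<sigma> (2 * ?j) = i \<or> \<sigma> (Suc (2 * ?j)) = i" using sl by metis
    then have "\<omega> [xs ! \<sigma> (2 * ?j), xs ! \<sigma> (Suc (2 * ?j))] = 0"
      using X V[OF j(1)] V[OF j(2)] by auto
    then show "\<exists>a\<in>{..<k}. \<omega> [((!) xs \<circ> \<sigma>) (2 * a), ((!) xs \<circ> \<sigma>) (Suc (2 * a))] = 0"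
      using l by (intro bexI[of _ ?j]) auto
  qed simp
  then show ?thesis by (simp add: wedge_power_altf altf_def)
qed

section \<open>Lie algebras\<close>

lemma wedge_1_1: "wedge 1 1 \<alpha> \<beta> [x, y] = \<alpha> [x] * \<beta> [y] - \<alpha> [y] * \<beta> [x]"
proof -
  have "{\<sigma>. \<sigma> permutes {..<1 + 1::nat}} = {id, Transposition.transpose 0 1}"
    using permutes_doubleton_iff[of _ 0 "1::nat"] by (auto simp: lessThan_Suc insert_commute)
  moreover have "id \<noteq> Transposition.transpose 0 (1::nat)"
    by (auto simp: fun_eq_iff Transposition.transpose_def)
  ultimately show ?thesis
    by (simp add: wedge_def sign_swap_id)
qed

text \<open>The six permutations pair up by the antisymmetry of \<omega>, which cancels the
  normalisation \<open>1 / 2\<close>.\<close>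

lemma wedge_1_2:
  assumes "\<omega> [y, x] = - \<omega> [x, y]" "\<omega> [z, x] = - \<omega> [x, z]" "\<omega> [z, y] = - \<omega> [y, z]"
  shows "wedge 1 2 \<alpha> \<omega> [x, y, z] = \<alpha> [x] * \<omega> [y, z] - \<alpha> [y] * \<omega> [x, z] + \<alpha> [z] * \<omega> [x, y]"
proof -
  have S: "{..<1 + 2::nat} = insert 0 (insert 1 {2})" by auto
  have f: "finite (insert 1 {2::nat})" "0 \<notin> insert 1 {2::nat}" "finite {2::nat}" "1 \<notin> {2::nat}"
    by auto
  have u: "[0..<1] = [0]" "[1..<1 + 2] = [1, 2]" by (simp_all add: upt_rec numeral_2_eq_2)
  show ?thesis
    unfolding wedge_def S sum_over_permutations_insert[OF f(1,2)]
      sum_over_permutations_insert[OF f(3,4)] permutes_sing u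
    by (simp add: sign_swap_id sign_compose permutation_swap_id assms)
qed

lemma ce_diff_1: "ce_diff g \<eta> [x, y] = - \<eta> [bracket g x y]"
  by (simp add: ce_diff_def nths_Cons)

lemma ce_diff_2: "ce_diff g \<omega> [x, y, z]
  = - \<omega> [bracket g x y, z] + \<omega> [bracket g x z, y] - \<omega> [bracket g y z, x]"
  by (simp add: ce_diff_def nths_Cons numeral_2_eq_2)

lemma lie_algebraD:
  assumes "lie_algebra g"
  shows "subspace (lspace g)" and "\<exists>S. finite S \<and> span S = lspace g"
    and "x \<in> lspace g \<Longrightarrow> y \<in> lspace g \<Longrightarrow> bracket g x y \<in> lspace g"
    and "x \<in> lspace g \<Longrightarrow> linear_within (lspace g) (bracket g x)"
    and "y \<in> lspace g \<Longrightarrow> linear_within (lspace g) (\<lambda>x. bracket g x y)"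
    and "x \<in> lspace g \<Longrightarrow> bracket g x x = 0"
    and "x \<in> lspace g \<Longrightarrow> y \<in> lspace g \<Longrightarrow> z \<in> lspace g \<Longrightarrow>
      bracket g x (bracket g y z) + bracket g y (bracket g z x) + bracket g z (bracket g x y) = 0"
  using assms by (auto simp: lie_algebra_def)

lemma bracket_anti:
  assumes g: "lie_algebra g" and xy: "x \<in> lspace g" "y \<in> lspace g"
  shows "bracket g y x = - bracket g x y"
proof -
  have "bracket g (x + y) (x + y) = 0"
    using lie_algebraD(6)[OF g] subspace_add[OF lie_algebraD(1)[OF g] xy] .
  then have "bracket g x y + bracket g y x = 0"
    using linear_withinD(1)[OF lie_algebraD(4)[OF g], of "x + y" x y]
      linear_withinD(1)[OF lie_algebraD(5)[OF g], of x x y]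
      linear_withinD(1)[OF lie_algebraD(5)[OF g], of y x y] xy lie_algebraD(6)[OF g]
    by (simp add: subspace_add[OF lie_algebraD(1)[OF g]] add.commute)
  then show ?thesis by (simp add: eq_neg_iff_add_eq_0 add.commute)
qed

text \<open>With \<Omega> = d\<eta> - \<theta> \<and> \<eta>, closedness of \<theta> and dd\<eta> =
  0 give d\<Omega> = \<theta> \<and> d\<eta>, which is \<theta> \<and> \<Omega> because \<theta>
  \<and> \<theta> = 0. Here dd\<eta> = 0 is the Jacobi identity under \<eta>.\<close>

lemma exact_lcs_form:
  assumes g: "lie_algebra g" and \<theta>: "linear_within (lspace g) (\<lambda>x. \<theta> [x])"
    and \<eta>: "linear_within (lspace g) (\<lambda>x. \<eta> [x])"
    and closed: "\<And>x y. x \<in> lspace g \<Longrightarrow> y \<in> lspace g \<Longrightarrow> \<theta> [bracket g x y] = 0"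
    and \<omega>: "\<And>x y. x \<in> lspace g \<Longrightarrow> y \<in> lspace g \<Longrightarrow>
      \<omega> [x, y] = - \<eta> [bracket g x y] - \<theta> [x] * \<eta> [y] + \<theta> [y] * \<eta> [x]"
  shows "exterior_form (lspace g) 2 \<omega>"
    and "form_eq (lspace g) 3 (ce_diff g \<omega>) (wedge 1 2 \<theta> \<omega>)"
proof -
  note L = lie_algebraD[OF g]
  note lins = linear_withinD[OF \<theta>] linear_withinD[OF \<eta>] linear_withinD[OF L(4)] linear_withinD[OF L(5)]
    L(3) \<omega> subspace_add[OF L(1)] subspace_scale[OF L(1)]
  show ext: "exterior_form (lspace g) 2 \<omega>"
    unfolding exterior_form_2 linear_within_def
  proof (intro ballI conjI allI)
    fix x y z and c :: real assume v: "x \<in> lspace g" "y \<in> lspace g" "z \<in> lspace g"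
    show "\<omega> [x, y + z] = \<omega> [x, y] + \<omega> [x, z]" "\<omega> [y + z, x] = \<omega> [y, x] + \<omega> [z, x]"
      using v by (simp_all add: lins algebra_simps)
    show "\<omega> [x, c *\<^sub>R y] = c *\<^sub>R \<omega> [x, y]" "\<omega> [c *\<^sub>R y, x] = c *\<^sub>R \<omega> [y, x]"
      using v by (simp_all add: lins algebra_simps)
    show "\<omega> [x, x] = 0"
      using v by (simp add: \<omega> L(6) linear_within_0[OF \<eta> L(1)])
  qed
  note anti = form_antisym[OF L(1) ext]
  show "form_eq (lspace g) 3 (ce_diff g \<omega>) (wedge 1 2 \<theta> \<omega>)"
    unfolding form_eq_3
  proof (intro ballI)
    fix x y z assume v: "x \<in> lspace g" "y \<in> lspace g" "z \<in> lspace g"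
    let ?b = "bracket g"
    have "?b x (?b y z) + ?b y (?b z x) + ?b z (?b x y) = 0" by (rule L(7)[OF v])
    \<comment> \<open>The Jacobi identity is brought to brackets nested on the left, as they occur
      in \<open>ce_diff_2\<close>.\<close>
    moreover have "?b x (?b y z) = - ?b (?b y z) x" "?b y (?b z x) = ?b (?b x z) y"
      "?b z (?b x y) = - ?b (?b x y) z"
    proof -
      show "?b x (?b y z) = - ?b (?b y z) x" by (rule bracket_anti[OF g L(3)[OF v(2,3)] v(1)])
      show "?b z (?b x y) = - ?b (?b x y) z" by (rule bracket_anti[OF g L(3)[OF v(1,2)] v(3)])
      have "?b y (?b x z) = - ?b y (?b z x)"
        unfolding bracket_anti[OF g v(3,1)]
        using linear_withinD(2)[OF L(4)[OF v(2)] L(3)[OF v(3,1)], of "-1"] by simp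
      then show "?b y (?b z x) = ?b (?b x z) y"
        using bracket_anti[OF g v(2) L(3)[OF v(1,3)]] by simp
    qed
    ultimately have "?b (?b x y) z = ?b (?b x z) y - ?b (?b y z) x"
      by (metis add.commute add_uminus_conv_diff add_eq_0_iff minus_minus)
    then have "\<eta> [?b (?b x y) z] = \<eta> [?b (?b x z) y] - \<eta> [?b (?b y z) x]"
      using linear_within_diff[OF \<eta> L(1) L(3)[OF L(3)[OF v(1,3)] v(2)] L(3)[OF L(3)[OF v(2,3)] v(1)]]
      by simp
    then show "ce_diff g \<omega> [x, y, z] = wedge 1 2 \<theta> \<omega> [x, y, z]"
      unfolding ce_diff_2 wedge_1_2[of \<omega>, OF anti[OF v(2,1)] anti[OF v(3,1)] anti[OF v(3,2)]]
      using v by (simp add: \<omega> L(3) closed) (simp add: algebra_simps)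
  qed
qed

lemma is_exact_lcsI:
  assumes g: "lie_algebra A" and "dim (lspace A) = 2 * n"
    and \<theta>: "linear_within (lspace A) (\<lambda>x. lee A [x])"
    and \<eta>: "linear_within (lspace A) (\<lambda>x. prim A [x])"
    and closed: "\<And>x y. x \<in> lspace A \<Longrightarrow> y \<in> lspace A \<Longrightarrow> lee A [bracket A x y] = 0"
    and \<omega>: "\<And>x y. x \<in> lspace A \<Longrightarrow> y \<in> lspace A \<Longrightarrow>
      Omega A [x, y] = - prim A [bracket A x y] - lee A [x] * prim A [y] + lee A [y] * prim A [x]"
    and "xs \<in> arguments (lspace A) (2 * n)" "wedge_power 2 (Omega A) n xs \<noteq> 0"
  shows "is_exact_lcs n A"
  unfolding is_exact_lcs_def is_lcs_def exterior_form_1 form_eq_2 ce_diff_1 wedge_1_1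
  using assms(1-4,7-8) exact_lcs_form[OF g \<theta> \<eta> closed \<omega>]
  by (simp add: closed \<omega>) (auto simp: form_eq_def)

section \<open>Kernels of linear functionals\<close>

lemma subspace_hyperplane:
  assumes "subspace V" "linear_within V l" shows "subspace {x \<in> V. l x = (0::real)}"
  using assms linear_withinD[OF assms(2)] linear_within_0[OF assms(2,1)]
  by (auto simp: subspace_def)

text \<open>A vector \<open>U\<close> off the kernel completes a basis of the kernel, since
  \<open>x - (l x / l U) *\<^sub>R U\<close> lies in it for every \<open>x\<close> in
  \<open>V\<close>.\<close>

lemma dim_hyperplane:
  assumes V: "subspace V" and S: "finite S" "V \<subseteq> span S" and l: "linear_within V l"
    and U: "U \<in> V" "l U \<noteq> (0::real)"
  shows "dim V = Suc (dim {x \<in> V. l x = 0})"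
    and "\<exists>B. finite B \<and> span B = {x \<in> V. l x = 0}"
proof -
  let ?H = "{x \<in> V. l x = 0}"
  have H: "subspace ?H" by (rule subspace_hyperplane[OF V l])
  obtain B where B: "B \<subseteq> ?H" "independent B" "?H \<subseteq> span B" "card B = dim ?H"
    using basis_exists by blast
  have fB: "finite B" using independent_span_bound[OF S(1) B(2)] B(1) S(2) by blast
  have sB: "span B = ?H" using B H by (simp add: span_minimal subset_antisym)
  then show "\<exists>B. finite B \<and> span B = ?H" using fB by blast
  have nU: "U \<notin> span B" using sB U by auto
  have "dim V = card (insert U B)"
  proof (rule dim_unique)
    show "insert U B \<subseteq> V" using U B by auto
    show "independent (insert U B)" using nU B(2) by (simp add: independent_insert)
    show "V \<subseteq> span (insert U B)"
    proof
      fix x assume x: "x \<in> V"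
      have "x - (l x / l U) *\<^sub>R U \<in> ?H"
        using x U linear_within_diff[OF l V x] linear_withinD(2)[OF l U(1)] V
        by (simp add: subspace_diff subspace_scale)
      then show "x \<in> span (insert U B)" using sB by (auto simp: span_insert)
    qed
  qed simp
  then show "dim V = Suc (dim ?H)"
    using fB B(4) nU span_base[of U B] by (auto simp: card_insert_if)
qed

section \<open>From exact lcs to contact Lie algebras\<close>

locale exact_lcs =
  fixes n :: nat and A :: "('a::real_vector, 'z) lcs_scheme"
  assumes exact: "is_exact_lcs n A"
begin

lemma lie: "lie_algebra A"
  and dim_lspace: "dim (lspace A) = 2 * n"
  and Omega_form: "exterior_form (lspace A) 2 (Omega A)"
  and lee_linear: "linear_within (lspace A) (\<lambda>x. lee A [x])"
  and prim_linear: "linear_within (lspace A) (\<lambda>x. prim A [x])"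
  using exact unfolding is_exact_lcs_def is_lcs_def exterior_form_1 by auto

lemma lee_closed: "x \<in> lspace A \<Longrightarrow> y \<in> lspace A \<Longrightarrow> lee A [bracket A x y] = 0"
  and Omega_eq: "x \<in> lspace A \<Longrightarrow> y \<in> lspace A \<Longrightarrow>
    Omega A [x, y] = - prim A [bracket A x y] - lee A [x] * prim A [y] + lee A [y] * prim A [x]"
  using exact unfolding is_exact_lcs_def is_lcs_def form_eq_2 ce_diff_1 wedge_1_1 by auto

lemma subspace_lspace: "subspace (lspace A)"
  by (rule lie_algebraD(1)[OF lie])

lemma finite_span: obtains S where "finite S" "lspace A \<subseteq> span S"
  using lie_algebraD(2)[OF lie] by auto

lemma Omega_anti: "x \<in> lspace A \<Longrightarrow> y \<in> lspace A \<Longrightarrow> Omega A [x, y] = - Omega A [y, x]"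
  by (rule form_antisym[OF subspace_lspace Omega_form])

lemma top_power:
  obtains xs where "xs \<in> arguments (lspace A) (2 * n)" "wedge_power 2 (Omega A) n xs \<noteq> 0"
  using exact unfolding is_exact_lcs_def is_lcs_def form_eq_def by auto

lemma top_power_form:
  "exterior_form (lspace A) (2 * n) (wedge_power 2 (Omega A) n)"
  by (rule exterior_form_wedge_power[OF Omega_form])

text \<open>A nonzero \<open>X\<close> can be inserted into a list on which the top power does not
  vanish, without losing nonvanishing; a radical \<open>X\<close> would force the value 0.\<close>

lemma nondegenerate:
  assumes X: "X \<in> lspace A" and rad: "\<forall>y\<in>lspace A. Omega A [X, y] = 0"
  shows "X = 0"
proof (rule ccontr)
  assume nz: "X \<noteq> 0"
  obtain S where S: "finite S" "lspace A \<subseteq> span S" by (rule finite_span)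
  obtain xs where xs: "xs \<in> arguments (lspace A) (2 * n)" "wedge_power 2 (Omega A) n xs \<noteq> 0"
    by (rule top_power)
  obtain i where i: "i < 2 * n" "wedge_power 2 (Omega A) n (xs[i := X]) \<noteq> 0"
    using nonzero_form_replace[OF subspace_lspace S, unfolded dim_lspace,
        OF top_power_form xs X nz] by blast
  have "wedge_power 2 (Omega A) n (xs[i := X]) = 0"
    using arguments_update[OF xs(1) X] i(1)
  proof (rule wedge_power_radical)
    fix y assume "y \<in> lspace A"
    moreover have "xs[i := X] ! i = X" using xs(1) i(1) by (auto simp: arguments_def)
    ultimately show "Omega A [xs[i := X] ! i, y] = 0 \<and> Omega A [y, xs[i := X] ! i] = 0"
      using rad Omega_anti[of y X] X by simp
  qed
  with i(2) show False by simp
qed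

lemma represent:
  assumes "linear_within (lspace A) l"
  obtains X where "X \<in> lspace A" "\<And>y. y \<in> lspace A \<Longrightarrow> Omega A [X, y] = l y"
proof -
  obtain S where S: "finite S" "lspace A \<subseteq> span S" by (rule finite_span)
  show ?thesis
    using Omega_form nondegenerate
    by (intro nondegenerate_represents[OF subspace_lspace S, of "\<lambda>x y. Omega A [x, y]", OF _ _ _ assms that])
      (auto simp: exterior_form_2)
qed

lemma determines_U_iff:
  "determines_U A U \<longleftrightarrow> U \<in> lspace A \<and> (\<forall>y\<in>lspace A. prim A [y] = - Omega A [U, y])"
  by (simp only: determines_U_def form_eq_1 interior_prod_def)

lemma ex1_U: "\<exists>!U. determines_U A U"
proof -
  have "linear_within (lspace A) (\<lambda>y. - prim A [y])"
    using prim_linear by (simp add: linear_within_def)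
  then obtain U where U: "U \<in> lspace A" "\<And>y. y \<in> lspace A \<Longrightarrow> Omega A [U, y] = - prim A [y]"
    using represent by blast
  show ?thesis
  proof (rule ex1I[of _ U])
    show "determines_U A U" using U by (simp add: determines_U_iff)
    fix U' assume "determines_U A U'"
    then have U': "U' \<in> lspace A" "\<And>y. y \<in> lspace A \<Longrightarrow> Omega A [U', y] = - prim A [y]"
      by (auto simp: determines_U_iff)
    have "U' - U = 0"
    proof (rule nondegenerate)
      show "U' - U \<in> lspace A" using U U' subspace_lspace by (simp add: subspace_diff)
      show "\<forall>y\<in>lspace A. Omega A [U' - U, y] = 0"
        using U U' linear_within_diff[where V = "lspace A" and f = "\<lambda>x. Omega A [x, y]" for y]
          Omega_form subspace_lspace by (simp add: exterior_form_2)
    qed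
    then show "U' = U" by simp
  qed
qed

abbreviation "U \<equiv> vecU A"
abbreviation "t \<equiv> lee A [U]"

lemma determines_vecU: "determines_U A U"
  unfolding vecU_def by (rule theI'[OF ex1_U])

lemma vecU_unique: "determines_U A X \<Longrightarrow> U = X"
  using ex1_U determines_vecU by blast

lemma U_in: "U \<in> lspace A"
  and Omega_U: "y \<in> lspace A \<Longrightarrow> Omega A [U, y] = - prim A [y]"
  using determines_vecU by (auto simp: determines_U_iff)

lemma prim_U: "prim A [U] = 0"
  using Omega_U[OF U_in] Omega_form U_in by (simp add: exterior_form_2)

lemma prim_ad_U:
  assumes "y \<in> lspace A" "lee A [y] = 0" shows "prim A [bracket A U y] = (1 - t) * prim A [y]"
  using Omega_U[OF assms(1)] Omega_eq[OF U_in assms(1)] assms(2) prim_U by (simp add: algebra_simps)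

text \<open>In Cartan's formula the two terms containing \<open>[y, z]\<close> cancel by
  antisymmetry.\<close>

lemma lie_deriv_Omega:
  assumes "X \<in> lspace A" "y \<in> lspace A" "z \<in> lspace A"
  shows "lie_deriv A X (Omega A) [y, z] = - Omega A [bracket A X y, z] - Omega A [y, bracket A X z]"
proof -
  have b: "bracket A y z \<in> lspace A" "bracket A X z \<in> lspace A"
    using assms lie_algebraD(3)[OF lie] by auto
  show ?thesis
    using Omega_anti[OF assms(1) b(1)] Omega_anti[OF assms(2) b(2)]
    by (simp add: lie_deriv_def ce_diff_1 ce_diff_2 interior_prod_def)
qed

text \<open>Contracting \<theta> \<and> \<Omega> with \<open>U\<close> gives \<open>t\<close>
  \<Omega> + \<theta> \<and> \<eta>, and the differential of the contraction of \<Omega> is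
  -d\<eta>. Together they make \<open>t\<close> \<Omega> - \<Omega>.\<close>

lemma lie_deriv_U_Omega:
  assumes "y \<in> lspace A" "z \<in> lspace A"
  shows "lie_deriv A U (Omega A) [y, z] = (t - 1) * Omega A [y, z]"
proof -
  have "ce_diff A (Omega A) [U, y, z] = wedge 1 2 (lee A) (Omega A) [U, y, z]"
    using exact U_in assms unfolding is_exact_lcs_def is_lcs_def form_eq_3 by blast
  also have "\<dots> = t * Omega A [y, z] - lee A [y] * Omega A [U, z] + lee A [z] * Omega A [U, y]"
    by (rule wedge_1_2) (intro Omega_anti U_in assms)+
  finally have "lie_deriv A U (Omega A) [y, z]
      = t * Omega A [y, z] + lee A [y] * prim A [z] - lee A [z] * prim A [y] - Omega A [U, bracket A y z]"
    using Omega_U assms by (simp add: lie_deriv_def ce_diff_1 interior_prod_def)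
  then show ?thesis
    using Omega_U[OF lie_algebraD(3)[OF lie assms]] by (simp add: Omega_eq[OF assms] algebra_simps)
qed

text \<open>
  For the forward implication, let \<open>V\<close> be dual to the Lee form.  An infinitesimal automorphism \<open>X\<close> satisfies
  \<open>\<eta>([X, V]) = 0\<close>, and evaluating \<open>\<Omega> = d\<eta> - \<theta> \<and> \<eta>\<close> on \<open>(X, V)\<close> gives \<open>\<theta>(X) = \<theta>(U) \<theta>(X)\<close>.
\<close>

lemma first_kind_iff: "first_kind A \<longleftrightarrow> t = 1"
proof
  assume "t = 1"
  then have "U \<in> lcs_automorphisms A"
    using lie_deriv_U_Omega U_in by (simp add: lcs_automorphisms_def form_eq_2)
  then show "first_kind A" using \<open>t = 1\<close> unfolding first_kind_def by (intro bexI[of _ U]) auto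
next
  assume "first_kind A"
  then obtain X where X: "X \<in> lspace A" "lee A [X] \<noteq> 0"
    and L: "\<And>y z. y \<in> lspace A \<Longrightarrow> z \<in> lspace A \<Longrightarrow> lie_deriv A X (Omega A) [y, z] = 0"
    unfolding first_kind_def lcs_automorphisms_def form_eq_2 by auto
  have "linear_within (lspace A) (\<lambda>y. - lee A [y])"
    using lee_linear by (simp add: linear_within_def)
  then obtain V where V: "V \<in> lspace A" "\<And>y. y \<in> lspace A \<Longrightarrow> Omega A [V, y] = - lee A [y]"
    using represent by blast
  have b: "bracket A X U \<in> lspace A" "bracket A X V \<in> lspace A"
    using X V U_in lie_algebraD(3)[OF lie] by auto
  \<comment> \<open>The Lee form is closed, so it vanishes on brackets. This leaves only \<Omega>(U,
    [X, V]) = -\<eta>([X, V]) in the vanishing Lie derivative at \<open>(U, V)\<close>.\<close>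
  have "Omega A [bracket A X U, V] = 0"
    using Omega_anti[OF b(1) V(1)] V(2)[OF b(1)] lee_closed[OF X(1) U_in] by simp
  then have "prim A [bracket A X V] = 0"
    using L[OF U_in V(1)] lie_deriv_Omega[OF X(1) U_in V(1)] Omega_U[OF b(2)] by simp
  moreover have "lee A [V] = 0"
    using V(2)[OF V(1)] V(1) Omega_form by (simp add: exterior_form_2)
  moreover have "prim A [V] = - t"
    using Omega_U[OF V(1)] Omega_anti[OF U_in V(1)] V(2)[OF U_in] by simp
  ultimately have "Omega A [X, V] = t * lee A [X]" using Omega_eq[OF X(1) V(1)] by simp
  moreover have "Omega A [X, V] = lee A [X]" using Omega_anti[OF X(1) V(1)] V(2)[OF X(1)] by simp
  ultimately show "t = 1" using X(2) by simp
qed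

end

section \<open>The contact structure on the kernel of the Lee form\<close>

locale transversal = exact_lcs n A for n and A :: "'a::real_vector lcs" +
  assumes t_nonzero: "lee A [vecU A] \<noteq> 0" and n_pos: "n > 0"
begin

abbreviation "h \<equiv> to_contact A"

lemma lspace_h: "lspace h = {X \<in> lspace A. lee A [X] = 0}"
  and bracket_h: "bracket h = bracket A" and cform_h: "cform h = prim A"
  and der_h: "der h = bracket A U"
  by (simp_all add: to_contact_def)

lemma h_subset: "lspace h \<subseteq> lspace A" by (auto simp: lspace_h)

lemma project:
  assumes "x \<in> lspace A" shows "x - (lee A [x] / t) *\<^sub>R U \<in> lspace h"
  using assms U_in t_nonzero linear_within_diff[OF lee_linear subspace_lspace assms]
    linear_withinD(2)[OF lee_linear U_in] subspace_lspace
  by (simp add: lspace_h subspace_diff subspace_scale)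

lemma lie_h: "lie_algebra h" and dim_h: "Suc (dim (lspace h)) = 2 * n"
proof -
  obtain S where S: "finite S" "lspace A \<subseteq> span S" by (rule finite_span)
  note hyp = dim_hyperplane[OF subspace_lspace S lee_linear U_in t_nonzero]
  show "Suc (dim (lspace h)) = 2 * n" using hyp(1) dim_lspace by (simp add: lspace_h)
  note L = lie_algebraD[OF lie]
  have "subspace (lspace h)"
    using subspace_hyperplane[OF subspace_lspace lee_linear] by (simp add: lspace_h)
  moreover have "\<exists>S. finite S \<and> span S = lspace h" using hyp(2) by (simp add: lspace_h)
  ultimately show "lie_algebra h"
    unfolding lie_algebra_def bracket_h
    using L(3-7) h_subset lee_closed
      linear_within_subset[OF L(4) h_subset] linear_within_subset[OF L(5) h_subset]
    by (intro conjI ballI) (auto simp: lspace_h)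
qed

text \<open>Since \<open>U\<close> is nonzero, it can be put first in a list on which the top power
  does not vanish. Projecting the other entries along \<open>U\<close> into the kernel keeps the
  value, and \<open>wedge_power_contract\<close> turns it into a value of the contact volume
  form.\<close>

lemma contact_h: "is_contact n h"
proof -
  obtain k where n: "n = Suc k" using n_pos by (cases n) auto
  obtain S where S: "finite S" "lspace A \<subseteq> span S" by (rule finite_span)
  obtain xs where xs: "xs \<in> arguments (lspace A) (2 * n)" "wedge_power 2 (Omega A) n xs \<noteq> 0"
    by (rule top_power)
  have "U \<noteq> 0" using t_nonzero linear_within_0[OF lee_linear subspace_lspace] by auto
  then obtain i where i: "i < 2 * n" "wedge_power 2 (Omega A) n (xs[i := U]) \<noteq> 0"
    using nonzero_form_replace[OF subspace_lspace S, unfolded dim_lspace,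
        OF top_power_form xs U_in] by blast
  obtain ys where ys: "ys \<in> arguments (lspace A) (2 * n - 1)"
    "wedge_power 2 (Omega A) n (U # ys) \<noteq> 0"
    by (rule nonzero_form_head[OF subspace_lspace top_power_form xs(1) i(1) U_in i(2)])
  define zs where "zs = map (\<lambda>y. y - (lee A [y] / t) *\<^sub>R U) ys"
  have "wedge_power 2 (Omega A) n (U # [] @ zs) = wedge_power 2 (Omega A) n (U # [] @ ys)"
    unfolding zs_def
    by (rule form_project[OF subspace_lspace _ U_in, where m = "2 * n - 1"])
      (use top_power_form ys n U_in subspace_lspace in \<open>auto intro: subspace_diff subspace_scale\<close>)
  then have nz: "wedge_power 2 (Omega A) (Suc k) (U # zs) \<noteq> 0" using ys(2) n by simp
  have zs: "zs \<in> arguments (lspace h) (Suc (2 * k))"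
    using ys(1) project n by (auto simp: zs_def arguments_def)
  have "wedge_power 2 (Omega A) (Suc k) (U # zs)
    = - real (Suc k) * wedge 1 (2 * k) (cform h) (wedge_power 2 (ce_diff h (cform h)) k) zs"
    by (rule wedge_power_contract[OF subspace_lspace Omega_form U_in h_subset _ _ zs])
      (use Omega_U Omega_eq in \<open>auto simp: lspace_h cform_h bracket_h ce_diff_1\<close>)
  then have "wedge 1 (2 * k) (cform h) (wedge_power 2 (ce_diff h (cform h)) k) zs \<noteq> 0"
    using nz by auto
  then have "\<not> form_eq (lspace h) (2 * n - 1)
         (wedge 1 (2 * (n - 1)) (cform h) (wedge_power 2 (ce_diff h (cform h)) (n - 1))) (\<lambda>_. 0)"
    using zs n by (auto simp: form_eq_def)
  moreover have "dim (lspace h) = 2 * n - 1" using dim_h by simp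
  moreover have "exterior_form (lspace h) 1 (cform h)"
    using linear_within_subset[OF prim_linear h_subset] by (simp add: exterior_form_1[simplified] cform_h)
  ultimately show ?thesis using lie_h by (simp add: is_contact_def)
qed

lemma eigenvalue_h: "has_eigenvalue h (1 - t)"
  unfolding has_eigenvalue_def form_eq_1 using prim_ad_U
  by (auto simp: pullback_def lspace_h cform_h der_h)

text \<open>The derivation rule for \<open>ad U\<close> is the Jacobi identity; the kernel is
  preserved because the Lee form vanishes on all brackets.\<close>

lemma derivation_h: "derivation h (der h)"
proof -
  note L = lie_algebraD[OF lie]
  have "bracket A U (bracket A x y) = bracket A (bracket A U x) y + bracket A x (bracket A U y)"
    if v: "x \<in> lspace A" "y \<in> lspace A" for x y
  proof -
    have "bracket A x (bracket A y U) = - bracket A x (bracket A U y)"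
      unfolding bracket_anti[OF lie U_in v(2)]
      using linear_withinD(2)[OF L(4)[OF v(1)] L(3)[OF U_in v(2)], of "-1"] by simp
    moreover have "bracket A y (bracket A U x) = - bracket A (bracket A U x) y"
      by (rule bracket_anti[OF lie L(3)[OF U_in v(1)] v(2)])
    ultimately show ?thesis using L(7)[OF U_in v] by (simp add: algebra_simps)
  qed
  then show ?thesis
    unfolding derivation_def der_h bracket_h
    using h_subset linear_within_subset[OF L(4)[OF U_in] h_subset] L(3)[OF U_in] lee_closed[OF U_in]
    by (auto simp: lspace_h)
qed

lemma contact_der_h: "contact_der n h"
  unfolding contact_der_def using contact_h derivation_h eigenvalue_h t_nonzero
  by (intro conjI exI[of _ "1 - t"]) auto

end

lemma transversal_lcs_iff:
  assumes "n > 0"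
  shows "transversal_lcs n A \<longleftrightarrow> transversal n A"
  using assms
  by (auto simp: transversal_lcs_def transversal_def exact_lcs_def transversal_axioms_def)

text \<open>Every term of the contact volume form has a value of \<eta> as a factor. A nonzero value
  is what makes the eigenvalue well defined.\<close>

lemma contact_form_nonzero:
  assumes B: "is_contact n B" and "n > 0"
  obtains x where "x \<in> lspace B" "cform B [x] \<noteq> 0"
proof -
  obtain k where n: "n = Suc k" using assms(2) by (cases n) auto
  obtain ys where ys: "ys \<in> arguments (lspace B) (Suc (2 * k))"
    "wedge 1 (2 * k) (cform B) (wedge_power 2 (ce_diff B (cform B)) k) ys \<noteq> 0"
    using B n by (auto simp: is_contact_def form_eq_def)
  have "\<exists>x\<in>lspace B. cform B [x] \<noteq> 0"
  proof (rule ccontr)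
    assume "\<not> ?thesis"
    then have "altf (Suc (2 * k)) (\<lambda>g. cform B [g 0] * pair_prod (\<lambda>x y. ce_diff B (cform B) [x, y]) k
        (\<lambda>j. g (1 + j))) ((!) ys) = altf (Suc (2 * k)) (\<lambda>g. 0) ((!) ys)"
      by (intro altf_cong_on[where V = "lspace B"]) (auto intro: arguments_nth[OF ys(1)])
    then show False using ys(2) unfolding wedge_1_power_altf by (simp add: altf_def)
  qed
  then show ?thesis using that by blast
qed

lemma eigenvalue_unique:
  assumes "is_contact n B" "n > 0" "has_eigenvalue B \<alpha>" "has_eigenvalue B \<beta>"
  shows "\<alpha> = \<beta>"
proof -
  obtain x where "x \<in> lspace B" "cform B [x] \<noteq> 0" by (rule contact_form_nonzero[OF assms(1,2)])
  then show ?thesis using assms(3,4) unfolding has_eigenvalue_def form_eq_1 by auto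
qed

section \<open>From contact to exact lcs Lie algebras\<close>

text \<open>The length matters because \<open>map f xs ! i\<close> agrees with
  \<open>f (xs ! i)\<close> only at positions of the list.\<close>

lemma wedge_1_power_pullback:
  fixes f :: "'a \<Rightarrow> 'b"
  assumes "length xs = Suc (2 * k)"
  shows "wedge 1 (2 * k) (pullback f \<eta>) (wedge_power 2 (pullback f \<omega>) k) xs
    = wedge 1 (2 * k) \<eta> (wedge_power 2 \<omega> k) (map f xs)"
proof -
  let ?P = "\<lambda>g. \<eta> [g 0] * pair_prod (\<lambda>x y. \<omega> [x, y]) k (\<lambda>j. g (1 + j))"
  have "altf (Suc (2 * k)) ?P ((!) (map f xs)) = altf (Suc (2 * k)) ?P (f \<circ> (!) xs)"
  proof (rule altf_cong)
    fix g g' :: "nat \<Rightarrow> 'b" assume "\<And>i. i < Suc (2 * k) \<Longrightarrow> g i = g' i"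
    then show "?P g = ?P g'" using pair_prod_cong[of k "\<lambda>j. g (1 + j)" "\<lambda>j. g' (1 + j)"] by simp
  qed (use assms in auto)
  then show ?thesis
    unfolding wedge_1_power_altf by (simp add: altf_def pair_prod_def pullback_def o_assoc)
qed

lemma to_lcs_simps:
  "lspace (to_lcs B) = lspace B \<times> UNIV"
  "bracket (to_lcs B) (x, a) (y, b) = (a *\<^sub>R der B y - b *\<^sub>R der B x + bracket B x y, 0)"
  "lee (to_lcs B) [(x, a)] = - a"
  "prim (to_lcs B) [(x, a)] = cform B [x]"
  by (simp_all add: to_lcs_def exact_lcs_of_def semidirect_def pullback_def)

lemma Omega_to_lcs:
  "Omega (to_lcs B) [p, q] = - prim (to_lcs B) [bracket (to_lcs B) p q]
    - lee (to_lcs B) [p] * prim (to_lcs B) [q] + lee (to_lcs B) [q] * prim (to_lcs B) [p]"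
  by (simp add: to_lcs_def exact_lcs_of_def ce_diff_1 wedge_1_1[simplified])

locale contact_eigen =
  fixes n :: nat and B :: "'a::real_vector contact" and \<alpha> :: real
  assumes contact_der: "contact_der n B" and eigenvalue: "has_eigenvalue B \<alpha>" and n_pos: "n > 0"
begin

lemma contact: "is_contact n B" and lie: "lie_algebra B"
  and cform_linear: "linear_within (lspace B) (\<lambda>x. cform B [x])"
  and derivation: "derivation B (der B)"
  using contact_der by (auto simp: contact_der_def is_contact_def exterior_form_1[simplified])

text \<open>\<open>contact_der\<close> provides some eigenvalue different from 1; by uniqueness it
  is the given \<alpha>.\<close>

lemma \<alpha>_ne_1: "\<alpha> \<noteq> 1"
  using contact_der eigenvalue eigenvalue_unique[OF contact n_pos] unfolding contact_der_def by auto

lemma subspace_lspace: "subspace (lspace B)"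
  by (rule lie_algebraD(1)[OF lie])

lemma D_in: "x \<in> lspace B \<Longrightarrow> der B x \<in> lspace B"
  and D_linear: "linear_within (lspace B) (der B)"
  and D_bracket: "x \<in> lspace B \<Longrightarrow> y \<in> lspace B \<Longrightarrow>
    der B (bracket B x y) = bracket B (der B x) y + bracket B x (der B y)"
  and cform_D: "x \<in> lspace B \<Longrightarrow> cform B [der B x] = \<alpha> * cform B [x]"
  using derivation eigenvalue
  by (auto simp: derivation_def has_eigenvalue_def form_eq_1[simplified] pullback_def)

abbreviation "g \<equiv> to_lcs B"

lemma lie_g: "lie_algebra g"
proof -
  note L = lie_algebraD[OF lie]
  note sub = subspace_add[OF L(1)] subspace_diff[OF L(1)] subspace_scale[OF L(1)] L(3) D_in
  note lin = linear_withinD[OF L(4)] linear_withinD[OF L(5)] linear_withinD[OF D_linear]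
    linear_within_diff[OF L(4) L(1)] linear_within_diff[OF L(5) L(1)] linear_within_diff[OF D_linear L(1)]
  have subg: "subspace (lspace B \<times> (UNIV :: real set))"
    by (intro subspace_Times L(1)) simp
  have fin: "\<exists>S. finite S \<and> span S = lspace B \<times> (UNIV :: real set)"
  proof -
    obtain S where S: "finite S" "span S = lspace B" using L(2) by auto
    let ?T = "insert (0, 1 :: real) ((\<lambda>x. (x, 0)) ` S)"
    have "linear (\<lambda>x :: 'a. (x, 0 :: real))" by (rule linearI) auto
    then have i: "span ((\<lambda>x. (x, 0 :: real)) ` S) = (\<lambda>x. (x, 0)) ` lspace B"
      using linear_span_image S(2) by metis
    have "p \<in> span ?T" if "fst p \<in> lspace B" for p
      unfolding span_insert i using that
      by (intro CollectI exI[of _ "snd p"]) (cases p, simp)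
    then have "span ?T = lspace B \<times> UNIV"
      unfolding span_insert i by auto
    then show ?thesis using S(1) by (intro exI[of _ ?T]) auto
  qed
  have jacobi: "bracket g p (bracket g q r) + bracket g q (bracket g r p) + bracket g r (bracket g p q) = 0"
    if "p \<in> lspace g" "q \<in> lspace g" "r \<in> lspace g" for p q r
  proof -
    obtain x a y b z c where p: "p = (x, a)" "q = (y, b)" "r = (z, c)" by (metis surj_pair)
    have v: "x \<in> lspace B" "y \<in> lspace B" "z \<in> lspace B" using that p by (auto simp: to_lcs_simps)
    \<comment> \<open>Brackets are oriented with the derivation on the left, and one term of the
      Jacobi identity of \<open>B\<close> is eliminated. The expanded identity then cancels
      termwise.\<close>
    have "bracket B z (der B y) = - bracket B (der B y) z" "bracket B x (der B z) = - bracket B (der B z) x"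
      "bracket B y (der B x) = - bracket B (der B x) y"
      using bracket_anti[OF lie D_in v(3)] bracket_anti[OF lie D_in v(1)] bracket_anti[OF lie D_in v(2)] v
      by auto
    moreover have "bracket B z (bracket B x y)
      = - bracket B x (bracket B y z) - bracket B y (bracket B z x)"
      using L(7)[OF v] by (simp add: algebra_simps eq_neg_iff_add_eq_0)
    ultimately show ?thesis
      using v
      by (simp add: p to_lcs_simps zero_prod_def lin sub D_bracket) (simp add: algebra_simps)
  qed
  show ?thesis
    unfolding lie_algebra_def
  proof (intro conjI ballI)
    show "subspace (lspace g)" "\<exists>S. finite S \<and> span S = lspace g"
      using subg fin by (simp_all add: to_lcs_simps)
    fix p q r assume pqr: "p \<in> lspace g" "q \<in> lspace g" "r \<in> lspace g"
    show "bracket g p (bracket g q r) + bracket g q (bracket g r p) + bracket g r (bracket g p q) = 0"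
      by (rule jacobi[OF pqr])
  next
    fix p q assume "p \<in> lspace g" "q \<in> lspace g"
    then show "bracket g p q \<in> lspace g"
      by (cases p; cases q) (simp add: to_lcs_simps sub)
  next
    fix p assume p: "p \<in> lspace g"
    show "linear_within (lspace g) (bracket g p)" "linear_within (lspace g) (\<lambda>q. bracket g q p)"
      using p by (cases p; force simp: to_lcs_simps linear_within_def lin sub algebra_simps)+
    show "bracket g p p = 0"
      using p by (cases p) (simp add: to_lcs_simps L(6) zero_prod_def)
  qed
qed

text \<open>The hyperplane of second coordinate 0 is a copy of \<open>lspace B\<close>, and
  \<open>(0, 1)\<close> is transversal to it.\<close>

lemma dim_g: "dim (lspace g) = 2 * n"
proof -
  obtain S where S: "finite S" "lspace g \<subseteq> span S" using lie_algebraD(2)[OF lie_g] by auto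
  have "dim {p \<in> lspace g. snd p = 0} = dim (lspace B)"
  proof -
    let ?i = "\<lambda>x :: 'a. (x, 0 :: real)"
    have lin: "linear ?i" by (rule linearI) auto
    have inj: "inj ?i" by (auto simp: inj_on_def)
    obtain C where C: "C \<subseteq> lspace B" "independent C" "lspace B \<subseteq> span C" "card C = dim (lspace B)"
      using basis_exists by blast
    have sp: "span C = lspace B" using C subspace_lspace by (simp add: span_minimal subset_antisym)
    show ?thesis
    proof (rule dim_unique)
      show "?i ` C \<subseteq> {p \<in> lspace g. snd p = 0}" using C(1) by (auto simp: to_lcs_simps)
      show "{p \<in> lspace g. snd p = 0} \<subseteq> span (?i ` C)"
        unfolding linear_span_image[OF lin] sp by (auto simp: to_lcs_simps)
      show "independent (?i ` C)"
        by (rule linear_independent_injective_image[OF lin C(2)]) (rule inj_on_subset[OF inj], simp)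
      show "card (?i ` C) = dim (lspace B)"
        using C(4) card_image[OF inj_on_subset[OF inj]] by auto
    qed
  qed
  moreover have "dim (lspace g) = Suc (dim {p \<in> lspace g. snd p = 0})"
    by (rule dim_hyperplane(1)[OF lie_algebraD(1)[OF lie_g] S, of snd "(0, 1)"])
      (use subspace_0[OF subspace_lspace] in \<open>auto simp: to_lcs_simps linear_within_def\<close>)
  moreover have "dim (lspace B) = 2 * n - 1" using contact by (simp add: is_contact_def)
  ultimately show ?thesis using n_pos by simp
qed

text \<open>For a vector \<open>(0, c)\<close>, contracting \<Omega> gives
  \<open>c (1 - \<alpha>) \<eta>\<close>: the bracket contributes \<open>- c \<alpha> \<eta>\<close>
  and the Lee form \<open>c \<eta>\<close>. Equating this with \<open>- \<eta>\<close> determines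
  \<open>c\<close>, which exists because \<alpha> differs from 1.\<close>

abbreviation "W \<equiv> (0 :: 'a, 1 / (\<alpha> - 1))"

lemma W_in: "W \<in> lspace g"
  using subspace_0[OF subspace_lspace] by (simp add: to_lcs_simps)

lemma bracket_W: "x \<in> lspace B \<Longrightarrow> bracket g W (x, a) = ((1 / (\<alpha> - 1)) *\<^sub>R der B x, 0)"
  using linear_within_0[OF D_linear subspace_lspace]
    linear_within_0[OF lie_algebraD(5)[OF lie] subspace_lspace]
  by (simp add: to_lcs_simps)

lemma Omega_W: "p \<in> lspace g \<Longrightarrow> Omega g [W, p] = - prim g [p]"
proof -
  assume "p \<in> lspace g"
  then obtain x a where p: "p = (x, a)" "x \<in> lspace B" by (auto simp: to_lcs_simps)
  have "cform B [0] = 0" by (rule linear_within_0[OF cform_linear subspace_lspace])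
  moreover have "cform B [(1 / (\<alpha> - 1)) *\<^sub>R der B x] = \<alpha> / (\<alpha> - 1) * cform B [x]"
    using linear_withinD(2)[OF cform_linear D_in[OF p(2)], of "1 / (\<alpha> - 1)"] cform_D[OF p(2)] by simp
  ultimately have "Omega g [W, p] = - (\<alpha> / (\<alpha> - 1)) * cform B [x] + 1 / (\<alpha> - 1) * cform B [x]"
    using bracket_W[OF p(2), of a] by (simp add: Omega_to_lcs p to_lcs_simps(3,4))
  also have "\<dots> = - ((\<alpha> - 1) / (\<alpha> - 1)) * cform B [x]"
    by (simp only: diff_divide_distrib) (simp add: algebra_simps)
  also have "\<dots> = - prim g [p]" using \<alpha>_ne_1 by (simp add: p to_lcs_simps)
  finally show ?thesis .
qed

text \<open>The contraction identity read backwards: prepending \<open>W\<close> to a list on which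
  the contact volume form does not vanish gives a nonzero value of the top power.\<close>

lemma exact_g: "is_exact_lcs n g"
proof -
  obtain k where n: "n = Suc k" using n_pos by (cases n) auto
  obtain ys where ys: "ys \<in> arguments (lspace B) (Suc (2 * k))"
    "wedge 1 (2 * k) (cform B) (wedge_power 2 (ce_diff B (cform B)) k) ys \<noteq> 0"
    using contact n by (auto simp: is_contact_def form_eq_def)
  \<comment> \<open>The list is lifted to height 0, that is into the kernel of the Lee form.\<close>
  define zs where "zs = map (\<lambda>y. (y, 0 :: real)) ys"
  let ?H = "lspace B \<times> {0 :: real}"
  have zs: "zs \<in> arguments ?H (Suc (2 * k))" "map fst zs = ys" "length zs = Suc (2 * k)"
    using ys(1) by (auto simp: zs_def arguments_def o_def)
  have lee: "linear_within (lspace g) (\<lambda>x. lee g [x])" and prim: "linear_within (lspace g) (\<lambda>x. prim g [x])"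
    using linear_withinD[OF cform_linear] by (auto simp: linear_within_def to_lcs_simps)
  have closed: "lee g [bracket g p q] = 0" if "p \<in> lspace g" "q \<in> lspace g" for p q
    by (cases p; cases q) (simp add: to_lcs_simps)
  have "wedge_power 2 (Omega g) (Suc k) (W # zs) = - real (Suc k) *
    wedge 1 (2 * k) (pullback fst (cform B)) (wedge_power 2 (pullback fst (ce_diff B (cform B))) k) zs"
  proof (rule wedge_power_contract[OF lie_algebraD(1)[OF lie_g] _ W_in _ _ _ zs(1)])
    show "exterior_form (lspace g) 2 (Omega g)"
      by (rule exact_lcs_form(1)[OF lie_g lee prim closed Omega_to_lcs])
    show "?H \<subseteq> lspace g" by (auto simp: to_lcs_simps)
    then show "pullback fst (cform B) [y] = - Omega g [W, y]" if "y \<in> ?H" for y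
      using Omega_W[of y] that by (auto simp: pullback_def to_lcs_simps)
    show "pullback fst (ce_diff B (cform B)) [p, q] = Omega g [p, q]" if "p \<in> ?H" "q \<in> ?H" for p q
      using that by (auto simp: pullback_def Omega_to_lcs to_lcs_simps ce_diff_1)
  qed
  then have "wedge_power 2 (Omega g) n (W # zs) \<noteq> 0"
    using ys(2) zs(2) n wedge_1_power_pullback[OF zs(3), of fst "cform B" "ce_diff B (cform B)"] by simp
  moreover have "W # zs \<in> arguments (lspace g) (2 * n)"
    using zs(1) W_in n by (auto simp: arguments_def to_lcs_simps)
  ultimately show ?thesis
    using is_exact_lcsI[OF lie_g dim_g lee prim closed Omega_to_lcs] by blast
qed

lemma vecU_g: "vecU g = W"
proof -
  interpret exact_lcs n g by unfold_locales (rule exact_g)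
  show ?thesis by (rule vecU_unique) (simp add: determines_U_iff W_in Omega_W)
qed

text \<open>Here \<alpha> belongs to the given derivation, whereas \<open>1 - \<vartheta>(U)\<close>
  is the eigenvalue \<alpha> / (\<alpha> - 1) of \<open>ad U\<close> on the kernel. Both vanish
  exactly when \<vartheta>(U) = 1.\<close>

lemma lee_vecU_g: "lee g [vecU g] = 1 / (1 - \<alpha>)"
  using \<alpha>_ne_1 by (simp add: vecU_g to_lcs_simps divide_simps)

lemma transversal_g: "transversal n g"
  by unfold_locales (use exact_g lee_vecU_g \<alpha>_ne_1 n_pos in auto)

end

section \<open>Isomorphisms\<close>

lemma lie_isoD:
  assumes "lie_iso f g g'"
  shows "linear_within (lspace g) f" and "bij_betw f (lspace g) (lspace g')"
    and "x \<in> lspace g \<Longrightarrow> y \<in> lspace g \<Longrightarrow> f (bracket g x y) = bracket g' (f x) (f y)"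
    and "x \<in> lspace g \<Longrightarrow> f x \<in> lspace g'"
  using assms by (auto simp: lie_iso_def dest: bij_betwE)

lemma lie_iso_compose:
  assumes f: "lie_iso f g g'" and f': "lie_iso f' g' g''"
  shows "lie_iso (f' \<circ> f) g g''"
  using lie_isoD[OF f] lie_isoD[OF f'] bij_betw_trans[OF lie_isoD(2)[OF f] lie_isoD(2)[OF f']]
  by (simp add: lie_iso_def linear_within_def)

lemma lie_iso_inv:
  assumes g: "lie_algebra g" and f: "lie_iso f g g'"
  defines "h \<equiv> inv_into (lspace g) f"
  shows "lie_iso h g' g" and "x \<in> lspace g \<Longrightarrow> h (f x) = x" and "y \<in> lspace g' \<Longrightarrow> f (h y) = y"
proof -
  note F = lie_isoD[OF f] and L = lie_algebraD[OF g]
  show hf: "h (f x) = x" if "x \<in> lspace g" for x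
    unfolding h_def by (rule bij_betw_inv_into_left[OF F(2) that])
  show fh: "f (h y) = y" if "y \<in> lspace g'" for y
    unfolding h_def by (rule bij_betw_inv_into_right[OF F(2) that])
  have bij: "bij_betw h (lspace g') (lspace g)" unfolding h_def by (rule bij_betw_inv_into[OF F(2)])
  have ex: "\<exists>x\<in>lspace g. y = f x" if "y \<in> lspace g'" for y
    using F(2) that by (auto simp: bij_betw_def)
  show "lie_iso h g' g"
    unfolding lie_iso_def linear_within_def
  proof (intro conjI ballI allI bij)
    fix x y and c :: real assume "x \<in> lspace g'" "y \<in> lspace g'"
    then obtain u v where uv: "u \<in> lspace g" "v \<in> lspace g" "x = f u" "y = f v" using ex by metis
    have s: "u + v \<in> lspace g" "c *\<^sub>R u \<in> lspace g" "bracket g u v \<in> lspace g"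
      using uv L by (auto simp: subspace_add subspace_scale)
    show "h (x + y) = h x + h y"
      using hf[OF s(1)] linear_withinD(1)[OF F(1) uv(1,2)] hf uv by simp
    show "h (c *\<^sub>R x) = c *\<^sub>R h x"
      using hf[OF s(2)] linear_withinD(2)[OF F(1) uv(1), of c] hf uv by simp
    show "h (bracket g' x y) = bracket g (h x) (h y)"
      using hf[OF s(3)] F(3)[OF uv(1,2)] hf uv by simp
  qed
qed

lemma contact_isomorphic_alt:
  "contact_isomorphic B B' \<longleftrightarrow> (\<exists>f. lie_iso f B B' \<and>
     (\<forall>x\<in>lspace B. cform B' [f x] = cform B [x] \<and> f (der B x) = der B' (f x)))"
  unfolding contact_isomorphic_def form_eq_1 by (auto simp: pullback_def)

lemma contact_isomorphic_sym:
  assumes B: "lie_algebra B" and D: "derivation B (der B)" and iso: "contact_isomorphic B B'"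
  shows "contact_isomorphic B' B"
proof -
  obtain f where f: "lie_iso f B B'"
    and ff: "\<And>x. x \<in> lspace B \<Longrightarrow> cform B' [f x] = cform B [x]"
      "\<And>x. x \<in> lspace B \<Longrightarrow> f (der B x) = der B' (f x)"
    using iso unfolding contact_isomorphic_alt by blast
  define h where "h = inv_into (lspace B) f"
  note h = lie_iso_inv[OF B f, folded h_def]
  have "cform B [h y] = cform B' [y] \<and> h (der B' y) = der B (h y)" if y: "y \<in> lspace B'" for y
  proof -
    have hy: "h y \<in> lspace B" by (rule lie_isoD(4)[OF h(1) y])
    have "der B (h y) \<in> lspace B" using D hy by (auto simp: derivation_def)
    then show ?thesis using ff[OF hy] h(3)[OF y] h(2)[of "der B (h y)"] by simp
  qed
  then show ?thesis unfolding contact_isomorphic_alt using h(1) by blast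
qed

text \<open>Makes the eigenvalue an invariant of the isomorphism class, from which the value of the
  Lee form on \<open>U\<close> is recovered.\<close>

lemma contact_isomorphic_eigenvalue:
  assumes D: "derivation B (der B)" and iso: "contact_isomorphic B B'" and e: "has_eigenvalue B' \<alpha>"
  shows "has_eigenvalue B \<alpha>"
proof -
  obtain f where f: "lie_iso f B B'"
    and ff: "\<And>x. x \<in> lspace B \<Longrightarrow> cform B' [f x] = cform B [x]"
      "\<And>x. x \<in> lspace B \<Longrightarrow> f (der B x) = der B' (f x)"
    using iso unfolding contact_isomorphic_alt by blast
  have "cform B [der B x] = \<alpha> * cform B [x]" if x: "x \<in> lspace B" for x
  proof -
    have Dx: "der B x \<in> lspace B" using D x by (simp add: derivation_def)
    have "cform B [der B x] = cform B' [der B' (f x)]" using ff(1)[OF Dx] ff(2)[OF x] by simp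
    also have "\<dots> = \<alpha> * cform B' [f x]"
      using e lie_isoD(4)[OF f x] by (simp add: has_eigenvalue_def form_eq_1[simplified] pullback_def)
    finally show ?thesis using ff(1)[OF x] by simp
  qed
  then show ?thesis by (simp add: has_eigenvalue_def form_eq_1[simplified] pullback_def)
qed

lemma contact_isomorphic_trans:
  assumes "contact_isomorphic B B'" "contact_isomorphic B' B''"
  shows "contact_isomorphic B B''"
proof -
  obtain f where f: "lie_iso f B B'"
    "\<And>x. x \<in> lspace B \<Longrightarrow> cform B' [f x] = cform B [x] \<and> f (der B x) = der B' (f x)"
    using assms(1) unfolding contact_isomorphic_alt by blast
  obtain f' where f': "lie_iso f' B' B''"
    "\<And>x. x \<in> lspace B' \<Longrightarrow> cform B'' [f' x] = cform B' [x] \<and> f' (der B' x) = der B'' (f' x)"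
    using assms(2) unfolding contact_isomorphic_alt by blast
  show ?thesis
    unfolding contact_isomorphic_alt
    using lie_iso_compose[OF f(1) f'(1)] f f' lie_isoD(4)[OF f(1)]
    by (intro exI[of _ "f' \<circ> f"]) simp
qed

text \<open>\<Omega> is determined by the bracket, the Lee form and the primitive, so preserving
  these suffices.\<close>

lemma lcs_isomorphicI:
  assumes f: "lie_iso f A A'"
    and "\<And>x. x \<in> lspace A \<Longrightarrow> lee A' [f x] = lee A [x]"
    and "\<And>x. x \<in> lspace A \<Longrightarrow> prim A' [f x] = prim A [x]"
    and \<Omega>: "\<And>x y. x \<in> lspace A \<Longrightarrow> y \<in> lspace A \<Longrightarrow>
      Omega A [x, y] = - prim A [bracket A x y] - lee A [x] * prim A [y] + lee A [y] * prim A [x]"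
    and \<Omega>': "\<And>x y. x \<in> lspace A' \<Longrightarrow> y \<in> lspace A' \<Longrightarrow>
      Omega A' [x, y] = - prim A' [bracket A' x y] - lee A' [x] * prim A' [y] + lee A' [y] * prim A' [x]"
    and closed: "\<And>x y. x \<in> lspace A \<Longrightarrow> y \<in> lspace A \<Longrightarrow> bracket A x y \<in> lspace A"
  shows "lcs_isomorphic A A'"
proof -
  have "Omega A' [f x, f y] = Omega A [x, y]" if v: "x \<in> lspace A" "y \<in> lspace A" for x y
    using assms(2,3) v closed[OF v] lie_isoD(4)[OF f] lie_isoD(3)[OF f v, symmetric]
    by (simp add: \<Omega> \<Omega>')
  then show ?thesis
    unfolding lcs_isomorphic_def form_eq_1 form_eq_2 using assms(1-3)
    by (intro exI[of _ f]) (simp add: pullback_def)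
qed

text \<open>Preserving \<Omega> and \<eta>, the isomorphism sends \<open>U\<close> to the vector
  determined on the other side and so intertwines the adjoint maps; preserving \<vartheta>, it maps
  kernel onto kernel.\<close>

lemma lcs_isomorphic_to_contact:
  assumes "transversal n A" "transversal n A'" and iso: "lcs_isomorphic A A'"
  shows "contact_isomorphic (to_contact A) (to_contact A')"
proof -
  interpret A: transversal n A by fact
  interpret A': transversal n A' by fact
  obtain f where f: "lie_iso f A A'"
    and \<Omega>: "\<And>x y. x \<in> lspace A \<Longrightarrow> y \<in> lspace A \<Longrightarrow> Omega A' [f x, f y] = Omega A [x, y]"
    and \<theta>: "\<And>x. x \<in> lspace A \<Longrightarrow> lee A' [f x] = lee A [x]"
    and \<eta>: "\<And>x. x \<in> lspace A \<Longrightarrow> prim A' [f x] = prim A [x]"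
    using iso unfolding lcs_isomorphic_def form_eq_1 form_eq_2 by (auto simp: pullback_def)
  note F = lie_isoD[OF f]
  have surj: "\<exists>x\<in>lspace A. y = f x" if "y \<in> lspace A'" for y
    using F(2) that by (auto simp: bij_betw_def)
  have "determines_U A' (f A.U)"
    unfolding A'.determines_U_iff
  proof (intro conjI ballI)
    show "f A.U \<in> lspace A'" by (rule F(4)[OF A.U_in])
    fix y assume "y \<in> lspace A'"
    then obtain x where x: "x \<in> lspace A" "y = f x" using surj by blast
    then show "prim A' [y] = - Omega A' [f A.U, y]" using \<eta> \<Omega> A.U_in A.Omega_U by simp
  qed
  then have U: "A'.U = f A.U" by (rule A'.vecU_unique)
  have "f ` lspace A.h = lspace A'.h"
    unfolding A.lspace_h A'.lspace_h using surj \<theta> F(4) by force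
  then have "bij_betw f (lspace A.h) (lspace A'.h)"
    using F(2) A.h_subset inj_on_subset unfolding bij_betw_def by blast
  then have "lie_iso f A.h A'.h"
    using linear_within_subset[OF F(1) A.h_subset] F(3) A.h_subset
    by (auto simp: lie_iso_def A.bracket_h A'.bracket_h subset_iff)
  then show ?thesis
    unfolding contact_isomorphic_alt
    using \<eta> F(3)[OF A.U_in] A.h_subset
    by (intro exI[of _ f]) (auto simp: A.cform_h A'.cform_h A.der_h A'.der_h U subset_iff)
qed

text \<open>Expanding \<open>[x + a U, y + b U]\<close> by bilinearity gives the semidirect bracket
  for \<open>ad U\<close>. The coordinate \<open>a\<close> is \<open>\<vartheta>(z) / t\<close> and
  not \<open>- \<vartheta>(z)\<close>, which is the source of the rescaled Lee form.\<close>

lemma (in transversal) adapted_iso: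
  "lie_iso (\<lambda>(x, a). x + a *\<^sub>R U) (semidirect h (der h)) A"
proof -
  let ?f = "\<lambda>(x, a). x + a *\<^sub>R U"
  note L = lie_algebraD[OF lie]
  note sub = subspace_add[OF L(1)] subspace_scale[OF L(1)] L(3) U_in
  note lin = linear_withinD[OF L(4)] linear_withinD[OF L(5)]
  have h: "x \<in> lspace A \<and> lee A [x] = 0" if "x \<in> lspace h" for x using that by (simp add: lspace_h)
  have lee_f: "lee A [x + a *\<^sub>R U] = a * t" if "x \<in> lspace h" for x a
    using linear_withinD[OF lee_linear] U_in sub h[OF that] by simp
  have "bij_betw ?f (lspace h \<times> UNIV) (lspace A)"
  proof (rule bij_betwI[where g = "\<lambda>z. (z - (lee A [z] / t) *\<^sub>R U, lee A [z] / t)"])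
    show "?f \<in> lspace h \<times> UNIV \<rightarrow> lspace A" using h sub by auto
    show "(\<lambda>z. (z - (lee A [z] / t) *\<^sub>R U, lee A [z] / t)) \<in> lspace A \<rightarrow> lspace h \<times> UNIV"
      using project by auto
    show "(?f p - (lee A [?f p] / t) *\<^sub>R U, lee A [?f p] / t) = p" if "p \<in> lspace h \<times> UNIV" for p
      using that lee_f t_nonzero by (cases p) simp
  qed simp
  moreover have "?f (bracket (semidirect h (der h)) (x, a) (y, b)) = bracket A (?f (x, a)) (?f (y, b))"
    if xy: "x \<in> lspace h" "y \<in> lspace h" for x y a b
  proof -
    have v: "x \<in> lspace A" "y \<in> lspace A" using xy h by auto
    have "bracket A x U = - bracket A U x" by (rule bracket_anti[OF lie U_in v(1)])
    moreover have "bracket A U U = 0" by (rule L(6)[OF U_in])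
    ultimately show ?thesis
      using v by (simp add: semidirect_def der_h bracket_h lin sub algebra_simps)
  qed
  ultimately show ?thesis
    unfolding lie_iso_def
    by (auto simp: semidirect_def linear_within_def algebra_simps)
qed

lemma semidirect_iso:
  assumes f: "lie_iso f B B'" and ff: "\<And>x. x \<in> lspace B \<Longrightarrow> f (der B x) = der B' (f x)"
    and B: "lie_algebra B" and D: "derivation B (der B)"
  shows "lie_iso (map_prod f id) (semidirect B (der B)) (semidirect B' (der B'))"
proof -
  note F = lie_isoD[OF f] and L = lie_algebraD[OF B]
  have D_in: "x \<in> lspace B \<Longrightarrow> der B x \<in> lspace B" for x using D by (simp add: derivation_def)
  have "bij_betw (map_prod f id) (lspace B \<times> UNIV) (lspace B' \<times> (UNIV :: real set))"
    using bij_betw_map_prod[OF F(2) bij_id] .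
  moreover have "f (a *\<^sub>R der B y - b *\<^sub>R der B x + bracket B x y)
      = a *\<^sub>R der B' (f y) - b *\<^sub>R der B' (f x) + bracket B' (f x) (f y)"
    if "x \<in> lspace B" "y \<in> lspace B" for x y a b
    using that linear_withinD[OF F(1)] linear_within_diff[OF F(1) L(1)] D_in F(3) ff L
    by (simp add: subspace_add subspace_diff subspace_scale)
  ultimately show ?thesis
    using linear_withinD[OF F(1)]
    by (auto simp: lie_iso_def semidirect_def linear_within_def)
qed

text \<open>The isomorphism \<open>f\<close> of the kernels is extended by sending \<open>U\<close>
  to the vector \<open>U\<close> of \<open>A'\<close>. The extension respects the Lee forms because
  both take the same value there, and the primitives because both vanish there.\<close>

lemma to_contact_isomorphic_lcs:
  assumes "transversal n A" "transversal n A'"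
    and iso: "contact_isomorphic (to_contact A) (to_contact A')"
  shows "lcs_isomorphic A A'"
proof -
  interpret A: transversal n A by fact
  interpret A': transversal n A' by fact
  obtain f where f: "lie_iso f A.h A'.h"
    and \<eta>: "\<And>x. x \<in> lspace A.h \<Longrightarrow> prim A' [f x] = prim A [x]"
    and D: "\<And>x. x \<in> lspace A.h \<Longrightarrow> f (der A.h x) = der A'.h (f x)"
    using iso unfolding contact_isomorphic_alt by (auto simp: A.cform_h A'.cform_h)
  note F = lie_isoD[OF f]
  have "has_eigenvalue A.h (1 - A'.t)"
    by (rule contact_isomorphic_eigenvalue[OF A.derivation_h iso A'.eigenvalue_h])
  \<comment> \<open>Both \<open>1 - A'.t\<close> and \<open>1 - A.t\<close> are eigenvalues of the
    same contact data.\<close>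
  then have t: "A'.t = A.t"
    using eigenvalue_unique[OF A.contact_h A.n_pos _ A.eigenvalue_h] by fastforce
  have lie_sd: "lie_algebra (semidirect A.h (der A.h))"
  proof -
    interpret c: contact_eigen n A.h "1 - A.t"
      by unfold_locales (rule A.contact_der_h A.eigenvalue_h A.n_pos)+
    show ?thesis using c.lie_g by (simp add: lie_algebra_def to_lcs_def exact_lcs_of_def)
  qed
  let ?\<Phi> = "\<lambda>(x, a). x + a *\<^sub>R A.U" and ?\<Phi>' = "\<lambda>(x, a). x + a *\<^sub>R A'.U"
  define \<Psi> where "\<Psi> = inv_into (lspace (semidirect A.h (der A.h))) ?\<Phi>"
  note \<Psi> = lie_iso_inv[OF lie_sd A.adapted_iso, folded \<Psi>_def]
  define G where "G = ?\<Phi>' \<circ> (map_prod f id \<circ> \<Psi>)"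
  have G: "lie_iso G A A'"
    unfolding G_def
    by (rule lie_iso_compose[OF lie_iso_compose[OF \<Psi>(1) semidirect_iso[OF f D A.lie_h A.derivation_h]]
          A'.adapted_iso])
  have "lee A' [G z] = lee A [z] \<and> prim A' [G z] = prim A [z]" if z: "z \<in> lspace A" for z
  proof -
    obtain x a where xa: "\<Psi> z = (x, a)" by (cases "\<Psi> z")
    then have x: "x \<in> lspace A.h" using lie_isoD(4)[OF \<Psi>(1) z] by (simp add: semidirect_def)
    have z_eq: "z = x + a *\<^sub>R A.U" and Gz: "G z = f x + a *\<^sub>R A'.U"
      using \<Psi>(3)[OF z] xa by (simp_all add: G_def)
    have xV: "x \<in> lspace A" "lee A [x] = 0" "f x \<in> lspace A'" "lee A' [f x] = 0"
      using x F(4)[OF x] by (auto simp: A.lspace_h A'.lspace_h)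
    show ?thesis
      unfolding z_eq Gz[unfolded z_eq]
      using xV \<eta>[OF x] t A.U_in A'.U_in A.prim_U A'.prim_U
        linear_withinD[OF A.lee_linear] linear_withinD[OF A'.lee_linear]
        linear_withinD[OF A.prim_linear] linear_withinD[OF A'.prim_linear]
        subspace_scale[OF A.subspace_lspace] subspace_scale[OF A'.subspace_lspace]
      by simp
  qed
  then show ?thesis
    using lcs_isomorphicI[OF G _ _ A.Omega_eq A'.Omega_eq lie_algebraD(3)[OF A.lie]] by simp
qed

text \<open>The adjoint map of \<open>W\<close> acts on height 0 as the derivation times
  \<open>1 / (\<alpha> - 1)\<close>.\<close>

lemma (in contact_eigen) contact_to_lcs:
  "contact_isomorphic (to_contact g) (B\<lparr>der := \<lambda>x. (1 / (\<alpha> - 1)) *\<^sub>R der B x\<rparr>)"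
proof -
  interpret g: transversal n g by (rule transversal_g)
  have ls: "lspace g.h = lspace B \<times> {0}" by (auto simp: g.lspace_h to_lcs_simps)
  have "bij_betw fst (lspace B \<times> {0 :: real}) (lspace B)"
    by (rule bij_betwI[where g = "\<lambda>x. (x, 0)"]) auto
  then have "lie_iso fst g.h (B\<lparr>der := \<lambda>x. (1 / (\<alpha> - 1)) *\<^sub>R der B x\<rparr>)"
    by (auto simp: lie_iso_def linear_within_def ls g.bracket_h to_lcs_simps)
  then show ?thesis
    unfolding contact_isomorphic_alt
    by (intro exI[of _ fst] conjI)
      (auto simp: ls g.cform_h g.der_h vecU_g bracket_W to_lcs_simps(4))
qed

text \<open>\<open>to_lcs\<close> takes \<open>- a\<close> as Lee form, while \<open>a\<close> is
  \<open>\<vartheta> / t\<close> in the adapted coordinates. The primitive is unchanged, and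
  \<Omega> on the right is rebuilt from it with the new Lee form.\<close>

lemma (in transversal) lcs_to_contact:
  "lcs_isomorphic (to_lcs h) (exact_lcs_of A (\<lambda>xs. - lee A xs / t) (prim A))"
proof (rule lcs_isomorphicI)
  let ?f = "\<lambda>(x, a). x + a *\<^sub>R U"
  show "lie_iso ?f (to_lcs h) (exact_lcs_of A (\<lambda>xs. - lee A xs / t) (prim A))"
    using adapted_iso by (simp add: lie_iso_def to_lcs_def exact_lcs_of_def)
  fix p assume "p \<in> lspace (to_lcs h)"
  then obtain x a where p: "p = (x, a)" "x \<in> lspace A" "lee A [x] = 0"
    by (auto simp: to_lcs_simps lspace_h)
  note s = U_in subspace_scale[OF subspace_lspace]
  show "lee (exact_lcs_of A (\<lambda>xs. - lee A xs / t) (prim A)) [?f p] = lee (to_lcs h) [p]"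
    using p linear_withinD[OF lee_linear] s t_nonzero
    by (simp add: to_lcs_simps) (simp add: exact_lcs_of_def)
  show "prim (exact_lcs_of A (\<lambda>xs. - lee A xs / t) (prim A)) [?f p] = prim (to_lcs h) [p]"
    using p linear_withinD[OF prim_linear] s prim_U
    by (simp add: to_lcs_simps) (simp add: exact_lcs_of_def cform_h)
next
  show "bracket (to_lcs h) p q \<in> lspace (to_lcs h)" if "p \<in> lspace (to_lcs h)" "q \<in> lspace (to_lcs h)" for p q
  proof -
    interpret c: contact_eigen n h "1 - t"
      by unfold_locales (rule contact_der_h eigenvalue_h n_pos)+
    show ?thesis by (rule lie_algebraD(3)[OF c.lie_g that])
  qed
qed (simp_all add: Omega_to_lcs exact_lcs_of_def ce_diff_1 wedge_1_1[simplified])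

section \<open>Rescaling the derivation\<close>

text \<open>Serves to compensate the factor that the round trip puts on the derivation.\<close>

definition scale_der :: "real \<Rightarrow> 'a::real_vector contact \<Rightarrow> 'a contact" where
  "scale_der c B = B\<lparr>der := \<lambda>x. c *\<^sub>R der B x\<rparr>"

lemma scale_der_simps [simp]:
  "lspace (scale_der c B) = lspace B" "bracket (scale_der c B) = bracket B"
  "cform (scale_der c B) = cform B" "der (scale_der c B) = (\<lambda>x. c *\<^sub>R der B x)"
  by (simp_all add: scale_der_def)

lemma scale_der_inverse: "c * d = 1 \<Longrightarrow> scale_der c (scale_der d B) = B"
  by (simp add: scale_der_def)

lemma scale_der_isomorphic:
  assumes D: "derivation B (der B)" and iso: "contact_isomorphic B B'"
  shows "contact_isomorphic (scale_der c B) (scale_der c B')"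
proof -
  obtain f where f: "lie_iso f B B'"
    "\<And>x. x \<in> lspace B \<Longrightarrow> cform B' [f x] = cform B [x] \<and> f (der B x) = der B' (f x)"
    using iso unfolding contact_isomorphic_alt by blast
  have "f (c *\<^sub>R der B x) = c *\<^sub>R der B' (f x)" if "x \<in> lspace B" for x
    using linear_withinD(2)[OF lie_isoD(1)[OF f(1)], of "der B x" c] f(2)[OF that] D that
    by (simp add: derivation_def)
  then show ?thesis
    unfolding contact_isomorphic_alt using f by (intro exI[of _ f]) (simp add: lie_iso_def)
qed

context contact_eigen
begin

lemma contact_eigen_scale:
  assumes "c * \<alpha> \<noteq> 1" shows "contact_eigen n (scale_der c B) (c * \<alpha>)"
proof
  show eig: "has_eigenvalue (scale_der c B) (c * \<alpha>)"
    using linear_withinD(2)[OF cform_linear D_in, of _ c] cform_D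
    by (simp add: has_eigenvalue_def form_eq_1[simplified] pullback_def)
  have ce: "ce_diff (scale_der c B) = ce_diff B" by (simp add: fun_eq_iff ce_diff_def)
  have "is_contact n (scale_der c B)"
    using contact by (simp add: is_contact_def lie_algebra_def ce)
  moreover have "derivation (scale_der c B) (der (scale_der c B))"
    using linear_withinD[OF D_linear] D_in D_bracket lie_algebraD(4,5)[OF lie]
      subspace_scale[OF subspace_lspace]
    by (auto simp: derivation_def linear_within_def scaleR_add_right)
  ultimately show "contact_der n (scale_der c B)"
    unfolding contact_der_def using eig assms by blast
qed (rule n_pos)

lemma contact_to_lcs': "contact_isomorphic (to_contact g) (scale_der (1 / (\<alpha> - 1)) B)"
  using contact_to_lcs by (simp add: scale_der_def)

text \<open>The rescaled data have eigenvalue \<beta> = \<alpha> / (\<alpha> - 1), so their round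
  trip multiplies by 1 / (\<beta> - 1) = \<alpha> - 1, which undoes the rescaling. This exhibits a
  preimage of \<open>B\<close> under \<open>to_contact\<close>.\<close>

lemma rescaled:
  defines "B' \<equiv> scale_der (1 / (\<alpha> - 1)) B"
  shows "contact_der n B'" and "transversal n (to_lcs B')"
    and "contact_isomorphic (to_contact (to_lcs B')) B"
proof -
  have "1 / (\<alpha> - 1) * \<alpha> \<noteq> 1" using \<alpha>_ne_1 by (simp add: field_simps)
  then interpret s: contact_eigen n B' "1 / (\<alpha> - 1) * \<alpha>"
    unfolding B'_def by (rule contact_eigen_scale)
  show "contact_der n B'" by (rule s.contact_der)
  show "transversal n (to_lcs B')" by (rule s.transversal_g)
  have "1 / (1 / (\<alpha> - 1) * \<alpha> - 1) * (1 / (\<alpha> - 1)) = 1" using \<alpha>_ne_1 by (simp add: field_simps)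
  then show "contact_isomorphic (to_contact (to_lcs B')) B"
    using s.contact_to_lcs' scale_der_inverse unfolding B'_def by metis
qed

end

text \<open>Through the round trip, isomorphy of the lcs structures amounts to isomorphy of the
  rescaled contact data. The two scales agree once the eigenvalues do, and can then be
  removed.\<close>

lemma to_lcs_isomorphic_iff:
  assumes "contact_eigen n B \<alpha>" "contact_eigen n B' \<alpha>'"
  shows "lcs_isomorphic (to_lcs B) (to_lcs B') \<longleftrightarrow> contact_isomorphic B B'"
proof -
  interpret B: contact_eigen n B \<alpha> by fact
  interpret B': contact_eigen n B' \<alpha>' by fact
  interpret g: transversal n B.g by (rule B.transversal_g)
  interpret g': transversal n B'.g by (rule B'.transversal_g)
  let ?s = "1 / (\<alpha> - 1)" and ?s' = "1 / (\<alpha>' - 1)"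
  note sym = contact_isomorphic_sym and trans = contact_isomorphic_trans
  have ne: "\<alpha> \<noteq> 1" "\<alpha>' \<noteq> 1" by (rule B.\<alpha>_ne_1 B'.\<alpha>_ne_1)+
  interpret sB: contact_eigen n "scale_der ?s B" "?s * \<alpha>"
    by (rule B.contact_eigen_scale) (use ne in \<open>simp add: field_simps\<close>)
  interpret sB': contact_eigen n "scale_der ?s' B'" "?s' * \<alpha>'"
    by (rule B'.contact_eigen_scale) (use ne in \<open>simp add: field_simps\<close>)
  show ?thesis
  proof
    assume "lcs_isomorphic (to_lcs B) (to_lcs B')"
    then have "contact_isomorphic g.h g'.h"
      by (rule lcs_isomorphic_to_contact[OF g.transversal_axioms g'.transversal_axioms])
    then have iso: "contact_isomorphic (scale_der ?s B) (scale_der ?s' B')"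
      by (intro trans[OF sym[OF g.lie_h g.derivation_h B.contact_to_lcs'] trans[OF _ B'.contact_to_lcs']])
    have "?s * \<alpha> = ?s' * \<alpha>'"
      by (rule eigenvalue_unique[OF sB.contact B.n_pos sB.eigenvalue
            contact_isomorphic_eigenvalue[OF sB.derivation iso sB'.eigenvalue]])
    \<comment> \<open>The map \<alpha> \<mapsto> \<alpha> / (\<alpha> - 1) is injective away from
      1.\<close>
    then have \<alpha>: "\<alpha>' = \<alpha>" using ne by (simp add: field_simps)
    have "(\<alpha> - 1) * ?s = 1" using ne by simp
    then show "contact_isomorphic B B'"
      using scale_der_isomorphic[OF sB.derivation iso, of "\<alpha> - 1"] unfolding \<alpha>
      by (simp only: scale_der_inverse)
  next
    assume iso: "contact_isomorphic B B'"
    have "\<alpha> = \<alpha>'"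
      by (rule eigenvalue_unique[OF B.contact B.n_pos B.eigenvalue
            contact_isomorphic_eigenvalue[OF B.derivation iso B'.eigenvalue]])
    then have "contact_isomorphic (scale_der ?s B) (scale_der ?s' B')"
      using scale_der_isomorphic[OF B.derivation iso] by simp
    then have "contact_isomorphic g.h g'.h"
      by (intro trans[OF B.contact_to_lcs' trans[OF _ sym[OF g'.lie_h g'.derivation_h B'.contact_to_lcs']]])
    then show "lcs_isomorphic (to_lcs B) (to_lcs B')"
      by (rule to_contact_isomorphic_lcs[OF g.transversal_axioms g'.transversal_axioms])
  qed
qed

text \<open>The witness is the kernel with derivation \<open>- ad U / t\<close>. Its lcs structure
  has contact data isomorphic to those of \<open>A\<close>, and isomorphic contact data force
  isomorphic lcs structures.\<close>

lemma (in transversal) lcs_of_contact: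
  "\<exists>B :: 'a contact. contact_der n B \<and> lcs_isomorphic (to_lcs B) A"
proof -
  interpret c: contact_eigen n h "1 - t"
    by unfold_locales (rule contact_der_h eigenvalue_h n_pos)+
  show ?thesis
    using c.rescaled to_contact_isomorphic_lcs[OF c.rescaled(2) transversal_axioms c.rescaled(3)] by blast
qed

lemma contact_eigenI: "contact_der n B \<Longrightarrow> has_eigenvalue B \<alpha> \<Longrightarrow> n > 0 \<Longrightarrow> contact_eigen n B \<alpha>"
  by unfold_locales

lemma contact_derE:
  assumes "contact_der n B" "n > 0" obtains \<alpha> where "contact_eigen n B \<alpha>"
proof -
  obtain \<alpha> where "has_eigenvalue B \<alpha>" using assms(1) by (auto simp: contact_der_def)
  then show ?thesis using that contact_eigenI assms by blast
qed

lemma transversal_eigenvalue: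
  assumes "transversal n A" "has_eigenvalue (to_contact A) \<alpha>"
  shows "(first_kind A \<longleftrightarrow> lee A [vecU A] = 1) \<and> (lee A [vecU A] = 1 \<longleftrightarrow> \<alpha> = 0)"
proof -
  interpret transversal n A by fact
  have "\<alpha> = 1 - t" by (rule eigenvalue_unique[OF contact_h n_pos assms(2) eigenvalue_h])
  then show ?thesis using first_kind_iff by auto
qed

lemma contact_eigenvalue:
  assumes "contact_eigen n B \<alpha>"
  shows "(first_kind (to_lcs B) \<longleftrightarrow> lee (to_lcs B) [vecU (to_lcs B)] = 1) \<and>
    (lee (to_lcs B) [vecU (to_lcs B)] = 1 \<longleftrightarrow> \<alpha> = 0)"
proof -
  interpret contact_eigen n B \<alpha> by fact
  interpret g: transversal n g by (rule transversal_g)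
  show ?thesis using g.first_kind_iff lee_vecU_g \<alpha>_ne_1 by (auto simp: divide_simps)
qed

theorem theorem1p4:
  fixes n :: nat
  assumes "n \<ge> 2"
  shows
    "\<comment> \<open>both constructions are well defined\<close>
     (\<forall>A :: 'a::real_vector lcs. is_exact_lcs n A \<longrightarrow> (\<exists>!U. determines_U A U)) \<and>
     (\<forall>A :: 'a lcs. transversal_lcs n A \<longrightarrow> contact_der n (to_contact A)) \<and>
     (\<forall>B :: 'b::real_vector contact. contact_der n B \<longrightarrow> transversal_lcs n (to_lcs B)) \<and>
     \<comment> \<open>each of them is a bijection between isomorphism classes\<close>
     (\<forall>(A :: 'a lcs) (A' :: 'c::real_vector lcs). transversal_lcs n A \<and> transversal_lcs n A' \<longrightarrow>
        (contact_isomorphic (to_contact A) (to_contact A') \<longleftrightarrow> lcs_isomorphic A A')) \<and>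
     (\<forall>B :: 'b contact. contact_der n B \<longrightarrow>
        (\<exists>A :: ('b \<times> real) lcs. transversal_lcs n A \<and> contact_isomorphic (to_contact A) B)) \<and>
     (\<forall>(B :: 'b contact) (B' :: 'd::real_vector contact). contact_der n B \<and> contact_der n B' \<longrightarrow>
        (lcs_isomorphic (to_lcs B) (to_lcs B') \<longleftrightarrow> contact_isomorphic B B')) \<and>
     (\<forall>A :: 'a lcs. transversal_lcs n A \<longrightarrow>
        (\<exists>B :: 'a contact. contact_der n B \<and> lcs_isomorphic (to_lcs B) A)) \<and>
     \<comment> \<open>they are mutually inverse up to isomorphism and the scale of the derivation, resp. Lee form\<close>
     (\<forall>(B :: 'b contact) \<alpha>. contact_der n B \<and> has_eigenvalue B \<alpha> \<longrightarrow>
        contact_isomorphic (to_contact (to_lcs B))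
          (B\<lparr>der := \<lambda>X. (1 / (\<alpha> - 1)) *\<^sub>R der B X\<rparr>)) \<and>
     (\<forall>A :: 'a lcs. transversal_lcs n A \<longrightarrow>
        lcs_isomorphic (to_lcs (to_contact A))
          (exact_lcs_of A (\<lambda>xs. - lee A xs / lee A [vecU A]) (prim A))) \<and>
     \<comment> \<open>the first kind, on either side of the correspondence\<close>
     (\<forall>(A :: 'a lcs) \<alpha>. transversal_lcs n A \<and> has_eigenvalue (to_contact A) \<alpha> \<longrightarrow>
        (first_kind A \<longleftrightarrow> lee A [vecU A] = 1) \<and> (lee A [vecU A] = 1 \<longleftrightarrow> \<alpha> = 0)) \<and>
     (\<forall>(B :: 'b contact) \<alpha>. contact_der n B \<and> has_eigenvalue B \<alpha> \<longrightarrow>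
        (first_kind (to_lcs B) \<longleftrightarrow> lee (to_lcs B) [vecU (to_lcs B)] = 1) \<and>
        (lee (to_lcs B) [vecU (to_lcs B)] = 1 \<longleftrightarrow> \<alpha> = 0))"
proof -
  have n: "n > 0" using assms by simp
  note iff = transversal_lcs_iff[OF n]
  show ?thesis
  proof (intro conjI allI impI, unfold iff)
    show "\<exists>!U. determines_U A U" if "is_exact_lcs n A" for A :: "'a lcs"
      using exact_lcs.ex1_U[OF exact_lcs.intro[OF that]] .
    show "contact_der n (to_contact A)" if "transversal n A" for A :: "'a lcs"
      using that by (rule transversal.contact_der_h)
    show "transversal n (to_lcs B)" if "contact_der n B" for B :: "'b contact"
      using contact_derE[OF that n] contact_eigen.transversal_g by metis
    show "contact_isomorphic (to_contact A) (to_contact A') \<longleftrightarrow> lcs_isomorphic A A'"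
      if "transversal n A \<and> transversal n A'" for A :: "'a lcs" and A' :: "'c lcs"
      using that lcs_isomorphic_to_contact to_contact_isomorphic_lcs by blast
    show "\<exists>A :: ('b \<times> real) lcs. transversal n A \<and> contact_isomorphic (to_contact A) B"
      if "contact_der n B" for B :: "'b contact"
      using contact_derE[OF that n] contact_eigen.rescaled(2,3) by metis
    show "lcs_isomorphic (to_lcs B) (to_lcs B') \<longleftrightarrow> contact_isomorphic B B'"
      if BB': "contact_der n B \<and> contact_der n B'" for B :: "'b contact" and B' :: "'d contact"
    proof -
      obtain \<alpha> \<alpha>' where "contact_eigen n B \<alpha>" "contact_eigen n B' \<alpha>'"
        using contact_derE[OF conjunct1[OF BB'] n] contact_derE[OF conjunct2[OF BB'] n] by metis
      then show ?thesis by (rule to_lcs_isomorphic_iff)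
    qed
    show "\<exists>B :: 'a contact. contact_der n B \<and> lcs_isomorphic (to_lcs B) A"
      if "transversal n A" for A :: "'a lcs"
      using that by (rule transversal.lcs_of_contact)
    show "contact_isomorphic (to_contact (to_lcs B)) (B\<lparr>der := \<lambda>X. (1 / (\<alpha> - 1)) *\<^sub>R der B X\<rparr>)"
      if "contact_der n B \<and> has_eigenvalue B \<alpha>" for B :: "'b contact" and \<alpha>
      using that n by (intro contact_eigen.contact_to_lcs contact_eigenI) auto
    show "lcs_isomorphic (to_lcs (to_contact A))
        (exact_lcs_of A (\<lambda>xs. - lee A xs / lee A [vecU A]) (prim A))"
      if "transversal n A" for A :: "'a lcs"
      using that by (rule transversal.lcs_to_contact)
    show "first_kind A \<longleftrightarrow> lee A [vecU A] = 1" "lee A [vecU A] = 1 \<longleftrightarrow> \<alpha> = 0"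
      if "transversal n A \<and> has_eigenvalue (to_contact A) \<alpha>" for A :: "'a lcs" and \<alpha>
      using that transversal_eigenvalue by blast+
    show "first_kind (to_lcs B) \<longleftrightarrow> lee (to_lcs B) [vecU (to_lcs B)] = 1"
      "lee (to_lcs B) [vecU (to_lcs B)] = 1 \<longleftrightarrow> \<alpha> = 0"
      if "contact_der n B \<and> has_eigenvalue B \<alpha>" for B :: "'b contact" and \<alpha>
      using that n contact_eigenvalue contact_eigenI by blast+
  qed
qed

end
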